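(* Let $(X,d)$ be a proper geodesic Busemann concave metric space and $x\in X$. If the tangent cone $(T_xX,d_x)$ is locally compact, then for each $r>0$ the family $\{(B^\lambda_r(x),\frac1\lambda d)\}_{\lambda\in(0,1]}$ is precompact with respect to the Gromov-Hausdorff topology, where $B_r^\lambda(x)$ denotes the ball of radius $r$ around $x$ with respect to the metric $\frac1\lambda d$. In particular, $(T_xX,d_x)$ is the (unique) pointed Gromov-Hausdorff limit of $\{(X,\frac1\lambda d,x)\}_{\lambda\in(0,1]}$ as $\lambda\to0$.
   Context: A metric space is proper if closed bounded subsets are compact. A geodesic from $x$ to $y$ is a map $\gamma:[0,1]\to X$ with $\gamma(0)=x$, $\gamma(1)=y$ and $d(\gamma(t),\gamma(s))=|t-s|\,d(x,y)$; $X$ is geodesic if any two points are joined by a geodesic. A geodesic space $(X,d)$ is Busemann concave if for all $x,y_1,y_2\in X$ and all geodesics $\gamma_i$ from $x$ to $y_i$ ($i=1,2$) the function $t\mapsto d(\gamma_1(t),\gamma_2(t))$ is concave on $[0,1]$. Tangent cone: let $\Gamma_x$ be the set of maximal (not further extendable) unit speed geodesics starting at $x$, and let $\hat T_xX$ be $\Gamma_x\times[0,\infty)$ with all points $(\gamma,0)$ identified. For $\gamma,\eta\in\Gamma_x$ choose $a>0$ such that both are defined on $[0,a]$ and set $$d_x((\gamma,s),(\eta,t))=\sup_{r\in(0,1],\ \max\{rs,rt\}\le a}\frac{d(\gamma(rs),\eta(rt))}{r}.$$ For Busemann concave $X$ this is a well-defined metric on $\hat T_xX$, and the tangent cone $(T_xX,d_x)$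 is the metric completion of $(\hat T_xX,d_x)$. Pointed Gromov-Hausdorff convergence of $(X_n,d_n,x_n)$ to $(Y,d_Y,y)$: for every $r>0$ the balls $B_r(x_n)\subset X_n$ converge to $B_r(y)\subset Y$ in the Gromov-Hausdorff distance, computed with isometric embeddings into common metric spaces mapping the base points to the same point. The base point of $T_xX$ is the apex, the class of the points $(\gamma,0)$.
   Formalization: Uniqueness of the pointed Gromov-Hausdorff limit is stated among complete pointed metric spaces, up to base-point preserving isometry; without completeness it fails, since for X = R the dense subspace Q is also a pointed limit. *)

theory Defs
  imports "HOL-Analysis.Analysis"
begin

section \<open>Geodesics and Busemann concavity\<close>

definition proper_space :: "'a::metric_space itself \<Rightarrow> bool" where
  "proper_space _ \<longleftrightarrow> (\<forall>S::'a set. closed S \<and> bounded S \<longrightarrow> compact S)"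

text \<open>Geodesics are parametrised on $[0,1]$; values outside $[0,1]$ are irrelevant.\<close>

definition geodesic :: "(real \<Rightarrow> 'a::metric_space) \<Rightarrow> 'a \<Rightarrow> 'a \<Rightarrow> bool" where
  "geodesic \<gamma> x y \<longleftrightarrow> \<gamma> 0 = x \<and> \<gamma> 1 = y \<and>
     (\<forall>t\<in>{0..1}. \<forall>s\<in>{0..1}. dist (\<gamma> t) (\<gamma> s) = \<bar>t - s\<bar> * dist x y)"

definition geodesic_space :: "'a::metric_space itself \<Rightarrow> bool" where
  "geodesic_space _ \<longleftrightarrow> (\<forall>x y::'a. \<exists>\<gamma>. geodesic \<gamma> x y)"

definition busemann_concave :: "'a::metric_space itself \<Rightarrow> bool" where
  "busemann_concave _ \<longleftrightarrow> geodesic_space TYPE('a) \<and>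
     (\<forall>(x::'a) y\<^sub>1 y\<^sub>2 \<gamma>\<^sub>1 \<gamma>\<^sub>2. geodesic \<gamma>\<^sub>1 x y\<^sub>1 \<longrightarrow> geodesic \<gamma>\<^sub>2 x y\<^sub>2 \<longrightarrow>
        concave_on {0..1} (\<lambda>t. dist (\<gamma>\<^sub>1 t) (\<gamma>\<^sub>2 t)))"


section \<open>Metric completion\<close>

text \<open>The completion of $(M,d)$ consists of the Cauchy sequences in $M$ modulo
  $d(\sigma_n,\tau_n)\to 0$. Distances in the locale \<^locale>\<open>Metric_space\<close> are total functions that
  are nonnegative and symmetric everywhere, so distances are set to 0 off the carrier here and below.\<close>

definition completion_rel :: "'a set \<Rightarrow> ('a \<Rightarrow> 'a \<Rightarrow> real) \<Rightarrow> ((nat \<Rightarrow> 'a) \<times> (nat \<Rightarrow> 'a)) set" where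
  "completion_rel M d = {(\<sigma>, \<tau>). Metric_space.MCauchy M d \<sigma> \<and> Metric_space.MCauchy M d \<tau> \<and>
     (\<lambda>n. d (\<sigma> n) (\<tau> n)) \<longlonglongrightarrow> 0}"

definition completion_carrier :: "'a set \<Rightarrow> ('a \<Rightarrow> 'a \<Rightarrow> real) \<Rightarrow> (nat \<Rightarrow> 'a) set set" where
  "completion_carrier M d = {\<sigma>. Metric_space.MCauchy M d \<sigma>} // completion_rel M d"

definition completion_dist ::
  "'a set \<Rightarrow> ('a \<Rightarrow> 'a \<Rightarrow> real) \<Rightarrow> (nat \<Rightarrow> 'a) set \<Rightarrow> (nat \<Rightarrow> 'a) set \<Rightarrow> real" where
  "completion_dist M d S T =
     (if S \<in> completion_carrier M d \<and> T \<in> completion_carrier M d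
      then lim (\<lambda>n. d ((SOME \<sigma>. \<sigma> \<in> S) n) ((SOME \<tau>. \<tau> \<in> T) n)) else 0)"

definition completion_embed :: "'a set \<Rightarrow> ('a \<Rightarrow> 'a \<Rightarrow> real) \<Rightarrow> 'a \<Rightarrow> (nat \<Rightarrow> 'a) set" where
  "completion_embed M d p = completion_rel M d `` {\<lambda>_. p}"


section \<open>The tangent cone\<close>

text \<open>A unit speed geodesic from \<open>x\<close> is a partial map whose domain is an interval in $[0,\infty)$
  with left endpoint \<open>0\<close>; then extension of geodesics is the relation \<open>\<subseteq>\<^sub>m\<close>. The domain is
  required to be different from \<open>{0}\<close>. This is automatic for maximal geodesics, unless the space
  is just \<open>{x}\<close>.\<close>

definition unit_speed_geodesic :: "'a::metric_space \<Rightarrow> (real \<rightharpoonup> 'a) \<Rightarrow> bool" where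
  "unit_speed_geodesic x \<gamma> \<longleftrightarrow>
     is_interval (dom \<gamma>) \<and> dom \<gamma> \<subseteq> {0..} \<and> dom \<gamma> \<noteq> {0} \<and> \<gamma> 0 = Some x \<and>
     (\<forall>s\<in>dom \<gamma>. \<forall>t\<in>dom \<gamma>. dist (the (\<gamma> s)) (the (\<gamma> t)) = \<bar>s - t\<bar>)"

definition maximal_rays :: "'a::metric_space \<Rightarrow> (real \<rightharpoonup> 'a) set" where
  "maximal_rays x = {\<gamma>. unit_speed_geodesic x \<gamma> \<and>
     (\<forall>\<eta>. unit_speed_geodesic x \<eta> \<and> \<gamma> \<subseteq>\<^sub>m \<eta> \<longrightarrow> \<eta> = \<gamma>)}"

text \<open>\<open>Apex\<close> is the common class of the points $(\gamma,0)$ and \<open>Ray \<gamma> s\<close>, for \<open>s > 0\<close>, is the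
  point $(\gamma,s)$. The apex is present even if there are no maximal geodesics, so the cone of a
  one-point space is a point.\<close>

datatype 'a cone_point = Apex | Ray "real \<rightharpoonup> 'a" real

definition cone_carrier :: "'a::metric_space \<Rightarrow> 'a cone_point set" where
  "cone_carrier x = insert Apex {Ray \<gamma> s | \<gamma> s. \<gamma> \<in> maximal_rays x \<and> 0 < s}"

fun cone_radius :: "'a cone_point \<Rightarrow> real" where
  "cone_radius Apex = 0"
| "cone_radius (Ray \<gamma> s) = s"

fun cone_dom :: "'a cone_point \<Rightarrow> real set" where
  "cone_dom Apex = {0..}"
| "cone_dom (Ray \<gamma> s) = dom \<gamma>"

text \<open>\<open>cone_eval x p r\<close> is $\gamma(rs)$ for \<open>p\<close> the class of $(\gamma,s)$; if \<open>p\<close> is the apex, then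
  $\gamma(r\cdot 0) = x$ for every choice of $\gamma$.\<close>

fun cone_eval :: "'a \<Rightarrow> 'a cone_point \<Rightarrow> real \<Rightarrow> 'a" where
  "cone_eval x Apex r = x"
| "cone_eval x (Ray \<gamma> s) r = the (\<gamma> (r * s))"

text \<open>The length \<open>a\<close> is an arbitrary choice, as in the mathematical definition; in a Busemann
  concave space the supremum does not depend on it.\<close>

definition cone_dist :: "'a::metric_space \<Rightarrow> 'a cone_point \<Rightarrow> 'a cone_point \<Rightarrow> real" where
  "cone_dist x p q =
     (if p \<in> cone_carrier x \<and> q \<in> cone_carrier x then
        let a = (SOME a. 0 < a \<and> {0..a} \<subseteq> cone_dom p \<inter> cone_dom q) in
        (SUP r\<in>{r. 0 < r \<and> r \<le> 1 \<and> max (r * cone_radius p) (r * cone_radius q) \<le> a}.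
           dist (cone_eval x p r) (cone_eval x q r) / r)
      else 0)"

definition tangent_cone :: "'a::metric_space \<Rightarrow> (nat \<Rightarrow> 'a cone_point) set set" where
  "tangent_cone x = completion_carrier (cone_carrier x) (cone_dist x)"

definition tangent_dist ::
  "'a::metric_space \<Rightarrow> (nat \<Rightarrow> 'a cone_point) set \<Rightarrow> (nat \<Rightarrow> 'a cone_point) set \<Rightarrow> real" where
  "tangent_dist x = completion_dist (cone_carrier x) (cone_dist x)"

definition tangent_apex :: "'a::metric_space \<Rightarrow> (nat \<Rightarrow> 'a cone_point) set" where
  "tangent_apex x = completion_embed (cone_carrier x) (cone_dist x) Apex"


section \<open>Gromov-Hausdorff convergence\<close>

definition hausdorff_dist :: "('a \<Rightarrow> 'a \<Rightarrow> real) \<Rightarrow> 'a set \<Rightarrow> 'a set \<Rightarrow> ennreal" where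
  "hausdorff_dist d S T = Inf {ennreal \<epsilon> | \<epsilon>. 0 < \<epsilon> \<and>
     (\<forall>s\<in>S. \<exists>t\<in>T. d s t < \<epsilon>) \<and> (\<forall>t\<in>T. \<exists>s\<in>S. d s t < \<epsilon>)}"

definition isometric_embedding ::
  "'a set \<Rightarrow> ('a \<Rightarrow> 'a \<Rightarrow> real) \<Rightarrow> 'b set \<Rightarrow> ('b \<Rightarrow> 'b \<Rightarrow> real) \<Rightarrow> ('a \<Rightarrow> 'b) \<Rightarrow> bool" where
  "isometric_embedding A dA Z dZ f \<longleftrightarrow>
     f ` A \<subseteq> Z \<and> (\<forall>u\<in>A. \<forall>v\<in>A. dZ (f u) (f v) = dA u v)"

text \<open>A common metric space \<open>Z\<close> can be shrunk to the union of the images of the two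
  embeddings, and so can be realised with a carrier in the sum type.\<close>

definition gh_dist ::
  "'a set \<Rightarrow> ('a \<Rightarrow> 'a \<Rightarrow> real) \<Rightarrow> 'b set \<Rightarrow> ('b \<Rightarrow> 'b \<Rightarrow> real) \<Rightarrow> ennreal" where
  "gh_dist A dA B dB = Inf {hausdorff_dist dZ (f ` A) (g ` B) | (Z :: ('a + 'b) set) dZ f g.
     Metric_space Z dZ \<and> isometric_embedding A dA Z dZ f \<and> isometric_embedding B dB Z dZ g}"

definition pointed_gh_dist ::
  "'a set \<Rightarrow> ('a \<Rightarrow> 'a \<Rightarrow> real) \<Rightarrow> 'a \<Rightarrow> 'b set \<Rightarrow> ('b \<Rightarrow> 'b \<Rightarrow> real) \<Rightarrow> 'b \<Rightarrow> ennreal" where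
  "pointed_gh_dist A dA a B dB b =
     Inf {hausdorff_dist dZ (f ` A) (g ` B) | (Z :: ('a + 'b) set) dZ f g.
       Metric_space Z dZ \<and> isometric_embedding A dA Z dZ f \<and> isometric_embedding B dB Z dZ g \<and>
       f a = g b}"

text \<open>Precompactness of a family: every sequence in it has a subsequence that converges to a compact
  metric space. A compact metric space has at most the cardinality of the continuum, so it is
  no restriction to take its points from \<^typ>\<open>real\<close> (with an arbitrary distance).\<close>

definition gh_precompact ::
  "'i set \<Rightarrow> ('i \<Rightarrow> 'a set) \<Rightarrow> ('i \<Rightarrow> 'a \<Rightarrow> 'a \<Rightarrow> real) \<Rightarrow> bool" where
  "gh_precompact I A d \<longleftrightarrow>
     (\<forall>\<iota> :: nat \<Rightarrow> 'i. range \<iota> \<subseteq> I \<longrightarrow>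
        (\<exists>\<rho> (K :: real set) dK. strict_mono \<rho> \<and>
           Metric_space K dK \<and> compact_space (Metric_space.mtopology K dK) \<and>
           (\<lambda>n. gh_dist (A (\<iota> (\<rho> n))) (d (\<iota> (\<rho> n))) K dK) \<longlonglongrightarrow> 0))"

definition pointed_gh_limit ::
  "('i \<Rightarrow> 'a set) \<Rightarrow> ('i \<Rightarrow> 'a \<Rightarrow> 'a \<Rightarrow> real) \<Rightarrow> ('i \<Rightarrow> 'a) \<Rightarrow>
   'b set \<Rightarrow> ('b \<Rightarrow> 'b \<Rightarrow> real) \<Rightarrow> 'b \<Rightarrow> 'i filter \<Rightarrow> bool" where
  "pointed_gh_limit M d p Y dY y F \<longleftrightarrow>
     Metric_space Y dY \<and> y \<in> Y \<and>
     (\<forall>r>0. ((\<lambda>i. pointed_gh_dist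
                     (Metric_space.mball (M i) (d i) (p i) r) (d i) (p i)
                     (Metric_space.mball Y dY y r) dY y) \<longlongrightarrow> 0) F)"

definition pointed_isometric ::
  "'a set \<Rightarrow> ('a \<Rightarrow> 'a \<Rightarrow> real) \<Rightarrow> 'a \<Rightarrow> 'b set \<Rightarrow> ('b \<Rightarrow> 'b \<Rightarrow> real) \<Rightarrow> 'b \<Rightarrow> bool" where
  "pointed_isometric A dA a B dB b \<longleftrightarrow>
     (\<exists>f. isometric_embedding A dA B dB f \<and> f ` A = B \<and> f a = b)"

definition scaled_dist :: "real \<Rightarrow> 'a::metric_space \<Rightarrow> 'a \<Rightarrow> real" where
  "scaled_dist l u v = 1 / l * dist u v"

end

theory Submission
  imports Defs
begin

text \<open>Busemann concavity makes $d(\gamma(rs),\eta(rt))/r$ nonincreasing in \<open>r\<close>. Hence the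
  evaluation map at scale \<open>l\<close>, which sends $(\gamma,s)$ to $\gamma(ls)$, is 1-Lipschitz to
  $(X, d/l)$ wherever it is defined on the cone, preserves the distance to the base point, and its distortion tends to 0 pointwise as
  $l \to 0$. It is onto, because every geodesic from \<open>x\<close> extends to a maximal ray. So the image of
  a finite net of a cone ball is a net of the rescaled ball of the same radius, almost isometric to
  the net for small \<open>l\<close>. Such nets exist: local compactness at the apex gives a totally bounded
  ball, and dilations of the cone carry this to every radius.

  A sequence of scales has a subsequence that converges to some $l \in [0,1]$. The balls converge to
  the ball of the tangent cone for $l = 0$ and, by contraction along geodesics, to the ball of
  $(X, d/l)$ for $l > 0$.\<close>

section \<open>Correspondences and Gromov-Hausdorff distance\<close>

text \<open>Spaces are compared through relations with bounded distortion. These compose with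
  additive errors and need no ambient space, so embeddings into a common space occur only where
  \<open>pointed_gh_dist\<close> is entered or left. Keeping the pair of base points in the relation
  gives the pointed statements. Two obstacles shape the route. Evaluation makes sense on rays and
  not on classes of Cauchy sequences, and a ray may be too short for a given scale. The comparison
  with X is therefore made on the uncompleted cone, through finite nets whose points can all be
  evaluated once the scale is small; density then passes the result to
  \<open>tangent_cone x\<close>. Moreover the balls are open and in general not compact, whereas
  \<open>gh_precompact\<close> asks for compact limits with points in \<open>real\<close>. Total
  boundedness is thus the working notion; a totally bounded space is completed and the completion is
  copied into \<open>real\<close>. Uniqueness needs limits of maps between spaces that may be
  uncountable, and a cluster point in a product space supplies them without a diagonal
  argument.\<close>

definition correspondence ::
  "real \<Rightarrow> 'a set \<Rightarrow> ('a \<Rightarrow> 'a \<Rightarrow> real) \<Rightarrow> 'b set \<Rightarrow> ('b \<Rightarrow> 'b \<Rightarrow> real) \<Rightarrow> ('a \<times> 'b) set \<Rightarrow> bool" where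
  "correspondence \<epsilon> A dA B dB R \<longleftrightarrow> R \<subseteq> A \<times> B \<and>
     (\<forall>u\<in>A. \<exists>v. (u, v) \<in> R) \<and> (\<forall>v\<in>B. \<exists>u. (u, v) \<in> R) \<and>
     (\<forall>(u, v)\<in>R. \<forall>(u', v')\<in>R. \<bar>dA u u' - dB v v'\<bar> \<le> \<epsilon>)"

lemma correspondenceI:
  assumes "R \<subseteq> A \<times> B"
    and "\<And>u. u \<in> A \<Longrightarrow> \<exists>v. (u, v) \<in> R" and "\<And>v. v \<in> B \<Longrightarrow> \<exists>u. (u, v) \<in> R"
    and "\<And>u v u' v'. (u, v) \<in> R \<Longrightarrow> (u', v') \<in> R \<Longrightarrow> \<bar>dA u u' - dB v v'\<bar> \<le> \<epsilon>"
  shows "correspondence \<epsilon> A dA B dB R"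
  using assms unfolding correspondence_def by blast

lemma correspondenceD:
  assumes "correspondence \<epsilon> A dA B dB R"
  shows "(u, v) \<in> R \<Longrightarrow> u \<in> A" "(u, v) \<in> R \<Longrightarrow> v \<in> B"
    and "u \<in> A \<Longrightarrow> \<exists>v. (u, v) \<in> R" "v \<in> B \<Longrightarrow> \<exists>u. (u, v) \<in> R"
    and "(u, v) \<in> R \<Longrightarrow> (u', v') \<in> R \<Longrightarrow> \<bar>dA u u' - dB v v'\<bar> \<le> \<epsilon>"
  using assms unfolding correspondence_def by blast+

lemma correspondence_mono:
  "correspondence \<epsilon> A dA B dB R \<Longrightarrow> \<epsilon> \<le> \<epsilon>' \<Longrightarrow> correspondence \<epsilon>' A dA B dB R"
  unfolding correspondence_def by fastforce

lemma correspondence_converse: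
  assumes "correspondence \<epsilon> A dA B dB R"
  shows "correspondence \<epsilon> B dB A dA (R\<inverse>)"
proof (rule correspondenceI)
  show "R\<inverse> \<subseteq> B \<times> A"
    using correspondenceD(1,2)[OF assms] by auto
  show "\<bar>dB u u' - dA v v'\<bar> \<le> \<epsilon>" if "(u, v) \<in> R\<inverse>" "(u', v') \<in> R\<inverse>" for u v u' v'
    using correspondenceD(5)[OF assms, of v u v' u'] that by (simp add: abs_minus_commute)
qed (use correspondenceD(3,4)[OF assms] in auto)

lemma correspondence_comp:
  assumes R: "correspondence \<epsilon> A dA B dB R" and S: "correspondence \<delta> B dB C dC S"
  shows "correspondence (\<epsilon> + \<delta>) A dA C dC (R O S)"
proof (rule correspondenceI)
  show "R O S \<subseteq> A \<times> C"
    using correspondenceD(1)[OF R] correspondenceD(2)[OF S] by auto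
  show "\<exists>v. (u, v) \<in> R O S" if "u \<in> A" for u
    using that correspondenceD(2,3)[OF R] correspondenceD(3)[OF S] by blast
  show "\<exists>u. (u, v) \<in> R O S" if "v \<in> C" for v
    using that correspondenceD(4)[OF R] correspondenceD(1,4)[OF S] by blast
  show "\<bar>dA u u' - dC v v'\<bar> \<le> \<epsilon> + \<delta>" if uv: "(u, v) \<in> R O S" "(u', v') \<in> R O S" for u v u' v'
  proof -
    obtain w w' where "(u, w) \<in> R" "(w, v) \<in> S" "(u', w') \<in> R" "(w', v') \<in> S"
      using uv by auto
    then have "\<bar>dA u u' - dB w w'\<bar> \<le> \<epsilon>" "\<bar>dB w w' - dC v v'\<bar> \<le> \<delta>"
      using correspondenceD(5)[OF R] correspondenceD(5)[OF S] by blast+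
    then show ?thesis by linarith
  qed
qed

lemma hausdorff_dist_le:
  assumes "0 < \<epsilon>" "\<And>s. s \<in> S \<Longrightarrow> \<exists>t\<in>T. d s t < \<epsilon>" "\<And>t. t \<in> T \<Longrightarrow> \<exists>s\<in>S. d s t < \<epsilon>"
  shows "hausdorff_dist d S T \<le> ennreal \<epsilon>"
  unfolding hausdorff_dist_def by (rule Inf_lower) (use assms in auto)

lemma hausdorff_dist_less:
  assumes "hausdorff_dist d S T < ennreal \<epsilon>"
  shows "(\<forall>s\<in>S. \<exists>t\<in>T. d s t < \<epsilon>) \<and> (\<forall>t\<in>T. \<exists>s\<in>S. d s t < \<epsilon>)"
proof -
  obtain \<delta> where \<delta>: "0 < \<delta>" "ennreal \<delta> < ennreal \<epsilon>"
    "\<forall>s\<in>S. \<exists>t\<in>T. d s t < \<delta>" "\<forall>t\<in>T. \<exists>s\<in>S. d s t < \<delta>"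
    using assms unfolding hausdorff_dist_def Inf_less_iff by blast
  then have "\<delta> < \<epsilon>"
    by (metis ennreal_less_iff less_imp_le)
  then show ?thesis
    using \<delta> by (meson less_trans)
qed

lemma gh_dist_le_pointed: "gh_dist A dA B dB \<le> pointed_gh_dist A dA a B dB b"
  unfolding gh_dist_def pointed_gh_dist_def by (rule Inf_superset_mono) auto

text \<open>Relate the points whose images in the common space are less than \<epsilon> apart.
  Replacing both endpoints of a distance costs \<epsilon> each, hence the distortion 2\<epsilon>;
  the base points have the same image and so are related.\<close>

lemma correspondence_of_pointed_gh_dist:
  fixes A :: "'a set" and B :: "'b set"
  assumes less: "pointed_gh_dist A dA a B dB b < ennreal \<epsilon>" and "a \<in> A" "b \<in> B" "0 < \<epsilon>"
  shows "\<exists>R. correspondence (2 * \<epsilon>) A dA B dB R \<and> (a, b) \<in> R"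
proof -
  obtain Z :: "('a + 'b) set" and dZ f g where Z: "Metric_space Z dZ"
    and f: "isometric_embedding A dA Z dZ f" and g: "isometric_embedding B dB Z dZ g"
    and ab: "f a = g b" and h: "hausdorff_dist dZ (f ` A) (g ` B) < ennreal \<epsilon>"
    using less unfolding pointed_gh_dist_def Inf_less_iff by blast
  interpret Metric_space Z dZ by fact
  have fZ: "f u \<in> Z" if "u \<in> A" for u
    using f that by (auto simp: isometric_embedding_def)
  have gZ: "g u \<in> Z" if "u \<in> B" for u
    using g that by (auto simp: isometric_embedding_def)
  define R where "R = {(u, v). u \<in> A \<and> v \<in> B \<and> dZ (f u) (g v) < \<epsilon>}"
  have "correspondence (2 * \<epsilon>) A dA B dB R"
  proof (rule correspondenceI)
    show "R \<subseteq> A \<times> B" by (auto simp: R_def)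
    show "\<exists>v. (u, v) \<in> R" if "u \<in> A" for u
      using hausdorff_dist_less[OF h] that by (auto simp: R_def)
    show "\<exists>u. (u, v) \<in> R" if "v \<in> B" for v
      using hausdorff_dist_less[OF h] that by (auto simp: R_def)
    fix u v u' v' assume uv: "(u, v) \<in> R" "(u', v') \<in> R"
    then have Z: "f u \<in> Z" "f u' \<in> Z" "g v \<in> Z" "g v' \<in> Z"
      by (auto simp: R_def fZ gZ)
    have "dA u u' = dZ (f u) (f u')" "dB v v' = dZ (g v) (g v')"
      using f g uv by (auto simp: isometric_embedding_def R_def)
    moreover have "dZ (f u) (f u') \<le> dZ (f u) (g v) + dZ (g v) (g v') + dZ (f u') (g v')"
      using Z by (smt (verit) commute triangle)
    moreover have "dZ (g v) (g v') \<le> dZ (f u) (g v) + dZ (f u) (f u') + dZ (f u') (g v')"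
      using Z by (smt (verit) commute triangle)
    ultimately show "\<bar>dA u u' - dB v v'\<bar> \<le> 2 * \<epsilon>"
      using uv by (auto simp: R_def)
  qed
  moreover have "(a, b) \<in> R"
    using assms ab gZ by (simp add: R_def)
  ultimately show ?thesis by blast
qed

text \<open>The distance of $u \in A$ and $v \in B$ is the length of a shortest path through a pair of the
  correspondence, where passing through the pair \<open>z\<close> costs \<open>w z\<close>. Weight 0 for the pair of base
  points puts these at distance 0, and then they can be identified.\<close>

definition glue_dist ::
  "('a \<Rightarrow> 'a \<Rightarrow> real) \<Rightarrow> ('b \<Rightarrow> 'b \<Rightarrow> real) \<Rightarrow> ('a \<times> 'b) set \<Rightarrow> ('a \<times> 'b \<Rightarrow> real) \<Rightarrow> 'a + 'b \<Rightarrow> 'a + 'b \<Rightarrow> real" where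
  "glue_dist dA dB R w p q = (case (p, q) of
      (Inl u, Inl u') \<Rightarrow> dA u u'
    | (Inr v, Inr v') \<Rightarrow> dB v v'
    | (Inl u, Inr v) \<Rightarrow> (INF z\<in>R. dA u (fst z) + w z + dB (snd z) v)
    | (Inr v, Inl u) \<Rightarrow> (INF z\<in>R. dA u (fst z) + w z + dB (snd z) v))"

text \<open>The gluing below is a metric on the disjoint union except that the two base points are
  at distance 0. Discarding one of them gives the common space. The factor 2 is not optimal; any
  fixed multiple of \<epsilon> serves the limits taken later.\<close>

lemma pointed_gh_dist_le:
  fixes A :: "'a set" and B :: "'b set"
  assumes A: "Metric_space A dA" and B: "Metric_space B dB"
    and R: "correspondence \<epsilon> A dA B dB R" and ab: "(a, b) \<in> R" and "0 < \<epsilon>"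
  shows "pointed_gh_dist A dA a B dB b \<le> ennreal (2 * \<epsilon>)"
proof -
  interpret A: Metric_space A dA by fact
  interpret B: Metric_space B dB by fact
  \<comment> \<open>The weight is \<epsilon> and not \<epsilon>/2: a pair compared with the base
    pair, whose weight is 0, has to absorb the whole distortion by itself.\<close>
  define w where "w z = (if z = (a, b) then 0 else \<epsilon>)" for z
  have w: "0 \<le> w z" "w z \<le> \<epsilon>" for z
    using \<open>0 < \<epsilon>\<close> by (auto simp: w_def)
  let ?D = "glue_dist dA dB R w"
  define c where "c u v z = dA u (fst z) + w z + dB (snd z) v" for u v z
  have D: "?D (Inl u) (Inl u') = dA u u'" "?D (Inr v) (Inr v') = dB v v'"
    "?D (Inl u) (Inr v) = (INF z\<in>R. c u v z)" "?D (Inr v) (Inl u) = (INF z\<in>R. c u v z)" for u u' v v'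
    by (simp_all add: glue_dist_def c_def)
  have RA: "fst z \<in> A" "snd z \<in> B" if "z \<in> R" for z
    using that correspondenceD(1,2)[OF R] by (metis prod.collapse)+
  have dis: "\<bar>dA (fst z) (fst z') - dB (snd z) (snd z')\<bar> \<le> w z + w z'" if "z \<in> R" "z' \<in> R" for z z'
  proof (cases "z = (a, b) \<and> z' = (a, b)")
    case True
    then show ?thesis using RA ab by (fastforce simp: w_def)
  next
    case False
    have "\<bar>dA (fst z) (fst z') - dB (snd z) (snd z')\<bar> \<le> \<epsilon>"
      using that correspondenceD(5)[OF R] by (metis prod.collapse)
    also have "\<epsilon> \<le> w z + w z'"
      using False \<open>0 < \<epsilon>\<close> by (auto simp: w_def)
    finally show ?thesis .
  qed
  have bdd: "bdd_below (c u v ` R)" for u v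
    by (rule bdd_belowI2[of _ 0]) (simp add: c_def w)
  have lower: "?D (Inl u) (Inr v) \<le> c u v z" if "z \<in> R" for u v z
    unfolding D using that bdd by (rule cINF_lower2[OF _ _ order_refl, rotated]) 
  have great: "m \<le> ?D (Inl u) (Inr v)" if "\<And>z. z \<in> R \<Longrightarrow> m \<le> c u v z" for m u v
    unfolding D using ab that by (intro cINF_greatest) auto
  have approx: "\<exists>z\<in>R. c u v z < ?D (Inl u) (Inr v) + e" if "0 < e" for u v e
    using great[of "?D (Inl u) (Inr v) + e" u v] that by force
  have sym: "?D p q = ?D q p" for p q
    by (cases p; cases q) (simp_all add: D A.commute B.commute)
  have nonneg: "0 \<le> ?D p q" for p q
    using great[of 0] w by (cases p; cases q) (force simp: D c_def)+
  \<comment> \<open>The names \<open>LLR\<close>, \<open>LRR\<close>, \<open>LRL\<close>,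
    \<open>RLR\<close> record the sides of the three points in a triangle inequality; the remaining
    mixed cases follow by symmetry. In the first two a single pair serves both sides. In the last
    two a path crosses twice, through different pairs, and there the distortion bound
    \<open>dis\<close> enters.\<close>
  have LLR: "?D (Inl u) (Inr v) \<le> dA u u' + ?D (Inl u') (Inr v)" if "u \<in> A" "u' \<in> A" "v \<in> B" for u u' v
  proof (rule field_le_epsilon)
    fix e :: real assume "0 < e"
    then obtain z where z: "z \<in> R" "c u' v z < ?D (Inl u') (Inr v) + e" using approx by blast
    have "?D (Inl u) (Inr v) \<le> c u v z" using lower z by blast
    also have "\<dots> \<le> dA u u' + c u' v z"
      using A.triangle[of u u' "fst z"] that RA z by (simp add: c_def)
    finally show "?D (Inl u) (Inr v) \<le> dA u u' + ?D (Inl u') (Inr v) + e" using z by simp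
  qed
  have LRR: "?D (Inl u) (Inr v) \<le> ?D (Inl u) (Inr v') + dB v' v" if "u \<in> A" "v' \<in> B" "v \<in> B" for u v v'
  proof (rule field_le_epsilon)
    fix e :: real assume "0 < e"
    then obtain z where z: "z \<in> R" "c u v' z < ?D (Inl u) (Inr v') + e" using approx by blast
    have "?D (Inl u) (Inr v) \<le> c u v z" using lower z by blast
    also have "\<dots> \<le> c u v' z + dB v' v"
      using B.triangle[of "snd z" v' v] that RA z by (simp add: c_def)
    finally show "?D (Inl u) (Inr v) \<le> ?D (Inl u) (Inr v') + dB v' v + e" using z by simp
  qed
  have LRL: "dA u u' \<le> ?D (Inl u) (Inr v) + ?D (Inl u') (Inr v)" if "u \<in> A" "u' \<in> A" "v \<in> B" for u u' v
  proof (rule field_le_epsilon)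
    fix e :: real assume "0 < e"
    then have "0 < e / 2" by simp
    then obtain z z' where z: "z \<in> R" "c u v z < ?D (Inl u) (Inr v) + e/2"
      "z' \<in> R" "c u' v z' < ?D (Inl u') (Inr v) + e/2" using approx by metis
    have "dA u u' \<le> dA u (fst z) + dA (fst z) (fst z') + dA u' (fst z')"
      using A.triangle[of u "fst z" u'] A.triangle[of "fst z" "fst z'" u'] that RA z
      by (simp add: A.commute)
    also have "\<dots> \<le> c u v z + c u' v z'"
      using dis[of z z'] B.triangle[of "snd z" v "snd z'"] that RA z
      by (simp add: c_def B.commute)
    finally show "dA u u' \<le> ?D (Inl u) (Inr v) + ?D (Inl u') (Inr v) + e" using z by simp
  qed
  have RLR: "dB v v' \<le> ?D (Inl u) (Inr v) + ?D (Inl u) (Inr v')" if "v \<in> B" "v' \<in> B" "u \<in> A" for u v v'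
  proof (rule field_le_epsilon)
    fix e :: real assume "0 < e"
    then have "0 < e / 2" by simp
    then obtain z z' where z: "z \<in> R" "c u v z < ?D (Inl u) (Inr v) + e/2"
      "z' \<in> R" "c u v' z' < ?D (Inl u) (Inr v') + e/2" using approx by metis
    have "dB v v' \<le> dB (snd z) v + dB (snd z) (snd z') + dB (snd z') v'"
      using B.triangle[of v "snd z" v'] B.triangle[of "snd z" "snd z'" v'] that RA z
      by (simp add: B.commute)
    also have "\<dots> \<le> c u v z + c u v' z'"
      using dis[of z z'] A.triangle[of "fst z" u "fst z'"] that RA z
      by (simp add: c_def A.commute)
    finally show "dB v v' \<le> ?D (Inl u) (Inr v) + ?D (Inl u) (Inr v') + e" using z by simp
  qed
  have aA: "a \<in> A" and bB: "b \<in> B" using RA ab by force+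
  \<comment> \<open>The point \<open>Inr b\<close> is left out because it is at distance 0 from
    \<open>Inl a\<close>; \<open>g\<close> below sends \<open>b\<close> to \<open>Inl a\<close>
    instead.\<close>
  define Z where "Z = Inl ` A \<union> Inr ` (B - {b})"
  \<comment> \<open>A path through the base pair costs at least \<open>dB b v\<close>, and one
    through any other pair at least \<epsilon>. Hence the infimum stays positive.\<close>
  have cross: "?D (Inl u) (Inr v) \<noteq> 0" if "u \<in> A" "v \<in> B" "v \<noteq> b" for u v
  proof -
    have "min \<epsilon> (dB b v) \<le> ?D (Inl u) (Inr v)"
    proof (rule great)
      fix z assume "z \<in> R"
      then show "min \<epsilon> (dB b v) \<le> c u v z"
        by (cases "z = (a, b)") (auto simp: c_def w_def min_le_iff_disj)
    qed
    moreover have "0 < min \<epsilon> (dB b v)"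
      using that bB \<open>0 < \<epsilon>\<close> by simp
    ultimately show ?thesis by linarith
  qed
  have Z: "Metric_space Z ?D"
  proof
    fix p q assume pq: "p \<in> Z" "q \<in> Z"
    show "(?D p q = 0) = (p = q)"
      using pq cross sym unfolding Z_def by (auto simp: D(1,2))
  next
    fix p q r assume "p \<in> Z" "q \<in> Z" "r \<in> Z"
    then have pqr: "p \<in> Inl ` A \<union> Inr ` B" "q \<in> Inl ` A \<union> Inr ` B" "r \<in> Inl ` A \<union> Inr ` B"
      by (auto simp: Z_def)
    have RL: "?D (Inr v) (Inl u) = ?D (Inl u) (Inr v)" for u v by (rule sym)
    show "?D p r \<le> ?D p q + ?D q r"
    proof (cases p; cases q; cases r)
      fix u v w assume "p = Inl u" "q = Inl v" "r = Inl w"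
      then show ?thesis using pqr A.triangle[of u v w] by (auto simp: D(1,2))
    next
      fix u v w assume "p = Inl u" "q = Inl v" "r = Inr w"
      then show ?thesis using pqr LLR[of u v w] by (auto simp: D(1,2))
    next
      fix u v w assume "p = Inl u" "q = Inr v" "r = Inl w"
      then show ?thesis using pqr LRL[of u w v] by (auto simp: D(1,2) RL)
    next
      fix u v w assume "p = Inl u" "q = Inr v" "r = Inr w"
      then show ?thesis using pqr LRR[of u v w] by (auto simp: D(1,2))
    next
      fix u v w assume "p = Inr u" "q = Inl v" "r = Inl w"
      then show ?thesis using pqr LLR[of w v u] by (auto simp: D(1,2) RL A.commute)
    next
      fix u v w assume "p = Inr u" "q = Inl v" "r = Inr w"
      then show ?thesis using pqr RLR[of u w v] by (auto simp: D(1,2) RL)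
    next
      fix u v w assume "p = Inr u" "q = Inr v" "r = Inl w"
      then show ?thesis using pqr LRR[of w v u] by (auto simp: D(1,2) RL B.commute)
    next
      fix u v w assume "p = Inr u" "q = Inr v" "r = Inr w"
      then show ?thesis using pqr B.triangle[of u v w] by (auto simp: D(1,2))
    qed
  qed (auto simp: nonneg sym)
  have l: "isometric_embedding A dA Z ?D Inl"
    by (auto simp: isometric_embedding_def Z_def D)
  define g where "g v = (if v = b then Inl a else Inr v)" for v
  have Dab: "?D (Inl a) (Inr b) = 0"
    using lower[OF ab, of a b] nonneg[of "Inl a" "Inr b"] aA bB by (simp add: c_def w_def)
  have ga: "?D (Inl u) (g v) = ?D (Inl u) (Inr v)" if "u \<in> A" "v \<in> B" for u v
  proof (cases "v = b")
    case True
    then show ?thesis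
      using LLR[of u a b] LRL[of u a b] that aA bB Dab by (simp add: g_def D(1))
  qed (simp add: g_def)
  have gr: "?D (g v) (Inr v') = dB v v'" if "v' \<in> B" "v \<in> B" for v v'
  proof (cases "v = b")
    case True
    then show ?thesis
      using LRR[of a b v'] RLR[of b v' a] that aA bB Dab by (simp add: g_def D(2))
  qed (simp add: g_def D(2))
  have g: "isometric_embedding B dB Z ?D g"
    unfolding isometric_embedding_def
  proof (intro conjI ballI)
    show "g ` B \<subseteq> Z" using aA by (auto simp: g_def Z_def)
    show "?D (g u) (g v) = dB u v" if "u \<in> B" "v \<in> B" for u v
    proof (cases "u = b")
      case True
      then show ?thesis using ga[of a v] gr[of v b] that aA bB by (simp add: g_def)
    next
      case False
      then have "?D (g u) (g v) = ?D (g v) (Inr u)" by (simp add: g_def sym)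
      then show ?thesis using gr[of u v] that by (simp add: B.commute)
    qed
  qed
  have ag: "Inl a = g b" by (simp add: g_def)
  \<comment> \<open>The gluing distance of related points is at most \<epsilon>; the larger bound
    supplies the strict inequality in \<open>hausdorff_dist\<close>.\<close>
  have near: "?D (Inl u) (g v) < 2 * \<epsilon>" if "(u, v) \<in> R" for u v
  proof -
    have "u \<in> A" "v \<in> B" using that correspondenceD(1,2)[OF R] by blast+
    then have "?D (Inl u) (g v) \<le> w (u, v)"
      using ga[of u v] lower[OF that, of u v] by (simp add: c_def)
    then show ?thesis using w(2)[of "(u, v)"] \<open>0 < \<epsilon>\<close> by linarith
  qed
  have h: "hausdorff_dist ?D (Inl ` A) (g ` B) \<le> ennreal (2 * \<epsilon>)"
  proof (rule hausdorff_dist_le)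
    show "\<exists>t\<in>g ` B. ?D s t < 2 * \<epsilon>" if s: "s \<in> Inl ` A" for s
    proof -
      obtain u where u: "u \<in> A" "s = Inl u" using s by auto
      obtain v where v: "(u, v) \<in> R" using correspondenceD(3)[OF R u(1)] by auto
      show ?thesis using near[OF v] correspondenceD(2)[OF R v] u by auto
    qed
    show "\<exists>s\<in>Inl ` A. ?D s t < 2 * \<epsilon>" if t: "t \<in> g ` B" for t
    proof -
      obtain v where v: "v \<in> B" "t = g v" using t by auto
      obtain u where u: "(u, v) \<in> R" using correspondenceD(4)[OF R v(1)] by auto
      show ?thesis using near[OF u] correspondenceD(1)[OF R u] v by auto
    qed
  qed (use \<open>0 < \<epsilon>\<close> in simp)
  have "pointed_gh_dist A dA a B dB b \<le> hausdorff_dist ?D (Inl ` A) (g ` B)"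
    unfolding pointed_gh_dist_def
    by (rule Inf_lower, rule CollectI, rule exI[of _ Z], rule exI[of _ ?D], rule exI[of _ Inl], rule exI[of _ g])
      (simp add: Z l g ag)
  then show ?thesis using h by (rule order_trans)
qed

lemma tendsto_ennreal_0I:
  fixes f :: "'i \<Rightarrow> ennreal"
  assumes "\<And>e. 0 < e \<Longrightarrow> eventually (\<lambda>i. f i \<le> ennreal e) F"
  shows "(f \<longlongrightarrow> 0) F"
proof (rule order_tendstoI)
  fix a :: ennreal assume "0 < a"
  then obtain b where "0 < b" "b < a" using dense by blast
  then obtain e where "b = ennreal e" "0 \<le> e" by (cases b) auto
  with \<open>0 < b\<close> \<open>b < a\<close> have "0 < e" "ennreal e < a" by (auto simp: ennreal_less_zero_iff)
  then show "eventually (\<lambda>i. f i < a) F"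
    by (auto elim!: eventually_mono[OF assms] intro: order_le_less_trans)
qed simp

section \<open>Total boundedness and its transfer along correspondences\<close>

lemma (in Metric_space) mtotally_bounded_space:
  "mtotally_bounded M \<longleftrightarrow> (\<forall>\<epsilon>>0. \<exists>N. finite N \<and> N \<subseteq> M \<and> (\<forall>u\<in>M. \<exists>v\<in>N. d v u < \<epsilon>))"
proof -
  have "M \<subseteq> (\<Union>x\<in>N. mball x \<epsilon>) \<longleftrightarrow> (\<forall>u\<in>M. \<exists>v\<in>N. d v u < \<epsilon>)" if "N \<subseteq> M" for N \<epsilon>
    using that by (auto simp: subset_iff)
  then show ?thesis
    unfolding mtotally_bounded_def by (metis (lifting))
qed

text \<open>A net is a condition at one fixed error, so a separate relation for each error is
  enough. Half of the error is spent on the net of \<open>A\<close>, half on the distortion.\<close>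

lemma mtotally_bounded_correspondence:
  assumes A: "Metric_space A dA" and B: "Metric_space B dB"
    and tb: "Metric_space.mtotally_bounded A dA A"
    and R: "\<And>\<epsilon>. 0 < \<epsilon> \<Longrightarrow> \<exists>R. correspondence \<epsilon> A dA B dB R"
  shows "Metric_space.mtotally_bounded B dB B"
  unfolding Metric_space.mtotally_bounded_space[OF B]
proof (intro allI impI)
  fix \<epsilon> :: real assume "0 < \<epsilon>"
  then obtain R where R: "correspondence (\<epsilon>/2) A dA B dB R" using R[of "\<epsilon>/2"] by auto
  obtain N where N: "finite N" "N \<subseteq> A" "\<forall>u\<in>A. \<exists>v\<in>N. dA v u < \<epsilon>/2"
    using tb \<open>0 < \<epsilon>\<close> unfolding Metric_space.mtotally_bounded_space[OF A] by (meson half_gt_zero)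
  obtain f where f: "\<And>u. u \<in> A \<Longrightarrow> (u, f u) \<in> R"
    using correspondenceD(3)[OF R] by metis
  show "\<exists>N. finite N \<and> N \<subseteq> B \<and> (\<forall>u\<in>B. \<exists>v\<in>N. dB v u < \<epsilon>)"
  proof (intro exI[of _ "f ` N"] conjI ballI)
    fix v assume "v \<in> B"
    then obtain u where u: "(u, v) \<in> R" "u \<in> A" using correspondenceD(1,4)[OF R] by blast
    then obtain n where n: "n \<in> N" "dA n u < \<epsilon>/2" using N by blast
    have "\<bar>dA n u - dB (f n) v\<bar> \<le> \<epsilon>/2"
      using correspondenceD(5)[OF R] f u n N by blast
    then have "dB (f n) v < \<epsilon>" using n by linarith
    then show "\<exists>v'\<in>f ` N. dB v' v < \<epsilon>" using n by blast
  qed (use N f correspondenceD(2)[OF R] in blast)+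
qed

section \<open>Completion and compact models\<close>

context Metric_space begin

abbreviation "CC \<equiv> completion_carrier M d"
abbreviation "CD \<equiv> completion_dist M d"
abbreviation "cclass \<sigma> \<equiv> completion_rel M d `` {\<sigma>}"

lemma MCauchyD: "MCauchy \<sigma> \<Longrightarrow> \<sigma> n \<in> M"
  by (auto simp: MCauchy_def)

lemma convergent_MCauchy_dist:
  assumes \<sigma>: "MCauchy \<sigma>" and \<tau>: "MCauchy \<tau>"
  shows "convergent (\<lambda>n. d (\<sigma> n) (\<tau> n))"
proof (rule real_Cauchy_convergent, rule metric_CauchyI)
  fix e :: real assume "0 < e"
  then have "0 < e/2" by simp
  then obtain N N' where N: "\<And>m n. N \<le> m \<Longrightarrow> N \<le> n \<Longrightarrow> d (\<sigma> m) (\<sigma> n) < e/2"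
    "\<And>m n. N' \<le> m \<Longrightarrow> N' \<le> n \<Longrightarrow> d (\<tau> m) (\<tau> n) < e/2"
    using \<sigma> \<tau> unfolding MCauchy_def by meson
  show "\<exists>K. \<forall>m\<ge>K. \<forall>n\<ge>K. dist (d (\<sigma> m) (\<tau> m)) (d (\<sigma> n) (\<tau> n)) < e"
  proof (intro exI[of _ "max N N'"] allI impI)
    fix m n assume "max N N' \<le> m" "max N N' \<le> n"
    then have "d (\<sigma> m) (\<sigma> n) < e/2" "d (\<tau> m) (\<tau> n) < e/2" using N by auto
    moreover have "d (\<sigma> m) (\<tau> m) \<le> d (\<sigma> m) (\<sigma> n) + d (\<sigma> n) (\<tau> n) + d (\<tau> m) (\<tau> n)"
      using triangle[of "\<sigma> m" "\<sigma> n" "\<tau> m"] triangle[of "\<sigma> n" "\<tau> n" "\<tau> m"] MCauchyD \<sigma> \<tau>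
      by (simp add: commute)
    moreover have "d (\<sigma> n) (\<tau> n) \<le> d (\<sigma> m) (\<sigma> n) + d (\<sigma> m) (\<tau> m) + d (\<tau> m) (\<tau> n)"
      using triangle[of "\<sigma> n" "\<sigma> m" "\<tau> n"] triangle[of "\<sigma> m" "\<tau> m" "\<tau> n"] MCauchyD \<sigma> \<tau>
      by (simp add: commute)
    ultimately show "dist (d (\<sigma> m) (\<tau> m)) (d (\<sigma> n) (\<tau> n)) < e"
      by (simp add: dist_real_def abs_less_iff)
  qed
qed

lemma completion_rel_iff:
  "(\<sigma>, \<tau>) \<in> completion_rel M d \<longleftrightarrow>
     MCauchy \<sigma> \<and> MCauchy \<tau> \<and> (\<lambda>n. d (\<sigma> n) (\<tau> n)) \<longlonglongrightarrow> 0"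
  by (simp add: completion_rel_def)

lemma equiv_completion_rel: "equiv {\<sigma>. MCauchy \<sigma>} (completion_rel M d)"
proof (rule equivI)
  show "refl_on {\<sigma>. MCauchy \<sigma>} (completion_rel M d)"
    by (auto simp: refl_on_def completion_rel_iff MCauchyD)
  show "sym (completion_rel M d)"
    by (rule symI) (simp add: completion_rel_iff commute)
  show "trans (completion_rel M d)"
  proof (rule transI)
    fix \<sigma> \<tau> \<rho> assume *: "(\<sigma>, \<tau>) \<in> completion_rel M d" "(\<tau>, \<rho>) \<in> completion_rel M d"
    have "(\<lambda>n. d (\<sigma> n) (\<rho> n)) \<longlonglongrightarrow> 0"
    proof (rule Lim_null_comparison)
      show "(\<lambda>n. d (\<sigma> n) (\<tau> n) + d (\<tau> n) (\<rho> n)) \<longlonglongrightarrow> 0"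
        using * tendsto_add[of "\<lambda>n. d (\<sigma> n) (\<tau> n)" 0 sequentially "\<lambda>n. d (\<tau> n) (\<rho> n)" 0]
        by (simp add: completion_rel_iff)
    qed (use * in \<open>auto simp: completion_rel_iff intro!: always_eventually triangle MCauchyD\<close>)
    then show "(\<sigma>, \<rho>) \<in> completion_rel M d" using * by (simp add: completion_rel_iff)
  qed
qed (auto simp: completion_rel_iff)

lemma cclass_in_completion [simp]: "MCauchy \<sigma> \<Longrightarrow> cclass \<sigma> \<in> CC"
  unfolding completion_carrier_def by (rule quotientI) simp

lemma completion_carrierE:
  assumes "S \<in> CC" obtains \<sigma> where "MCauchy \<sigma>" "S = cclass \<sigma>"
  using assms unfolding completion_carrier_def by (elim quotientE) auto

lemma cclass_eq_iff:
  "MCauchy \<sigma> \<Longrightarrow> MCauchy \<tau> \<Longrightarrow> cclass \<sigma> = cclass \<tau> \<longleftrightarrow> (\<lambda>n. d (\<sigma> n) (\<tau> n)) \<longlonglongrightarrow> 0"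
  using eq_equiv_class_iff[OF equiv_completion_rel, of \<sigma> \<tau>] by (simp add: completion_rel_iff)

text \<open>The definition takes the limit along representatives chosen by \<open>SOME\<close>.
  Changing representatives alters the distances by a null sequence, so any representatives may be
  used from here on.\<close>

lemma tendsto_completion_dist:
  assumes \<sigma>: "MCauchy \<sigma>" and \<tau>: "MCauchy \<tau>"
  shows "(\<lambda>n. d (\<sigma> n) (\<tau> n)) \<longlonglongrightarrow> CD (cclass \<sigma>) (cclass \<tau>)"
proof -
  define \<sigma>' \<tau>' where "\<sigma>' = (SOME \<rho>. \<rho> \<in> cclass \<sigma>)" and "\<tau>' = (SOME \<rho>. \<rho> \<in> cclass \<tau>)"
  have "\<sigma> \<in> cclass \<sigma>" "\<tau> \<in> cclass \<tau>"
    using \<sigma> \<tau> by (auto simp: completion_rel_iff MCauchyD)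
  then have "\<sigma>' \<in> cclass \<sigma>" "\<tau>' \<in> cclass \<tau>"
    unfolding \<sigma>'_def \<tau>'_def
    using someI[of "\<lambda>\<rho>. \<rho> \<in> cclass \<sigma>" \<sigma>] someI[of "\<lambda>\<rho>. \<rho> \<in> cclass \<tau>" \<tau>] by blast+
  then have C: "MCauchy \<sigma>'" "MCauchy \<tau>'"
    and 0: "(\<lambda>n. d (\<sigma> n) (\<sigma>' n)) \<longlonglongrightarrow> 0" "(\<lambda>n. d (\<tau> n) (\<tau>' n)) \<longlonglongrightarrow> 0"
    by (auto simp: completion_rel_iff)
  have lim: "(\<lambda>n. d (\<sigma>' n) (\<tau>' n)) \<longlonglongrightarrow> CD (cclass \<sigma>) (cclass \<tau>)"
    using convergent_MCauchy_dist[OF C] \<sigma> \<tau>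
    by (simp add: completion_dist_def \<sigma>'_def \<tau>'_def convergent_LIMSEQ_iff)
  have "(\<lambda>n. d (\<sigma> n) (\<tau> n) - d (\<sigma>' n) (\<tau>' n)) \<longlonglongrightarrow> 0"
  proof (rule Lim_null_comparison)
    show "(\<lambda>n. d (\<sigma> n) (\<sigma>' n) + d (\<tau> n) (\<tau>' n)) \<longlonglongrightarrow> 0"
      using tendsto_add[OF 0] by simp
    show "\<forall>\<^sub>F n in sequentially. norm (d (\<sigma> n) (\<tau> n) - d (\<sigma>' n) (\<tau>' n)) \<le> d (\<sigma> n) (\<sigma>' n) + d (\<tau> n) (\<tau>' n)"
    proof (rule always_eventually, rule allI)
      fix n
      have "\<sigma> n \<in> M" "\<tau> n \<in> M" "\<sigma>' n \<in> M" "\<tau>' n \<in> M" using MCauchyD C \<sigma> \<tau> by auto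
      then show "norm (d (\<sigma> n) (\<tau> n) - d (\<sigma>' n) (\<tau>' n)) \<le> d (\<sigma> n) (\<sigma>' n) + d (\<tau> n) (\<tau>' n)"
        using triangle[of "\<sigma> n" "\<sigma>' n" "\<tau> n"] triangle[of "\<sigma>' n" "\<tau>' n" "\<tau> n"]
          triangle[of "\<sigma>' n" "\<sigma> n" "\<tau>' n"] triangle[of "\<sigma> n" "\<tau> n" "\<tau>' n"]
        by (simp add: abs_le_iff commute)
    qed
  qed
  then show ?thesis
    using tendsto_add[OF _ lim, of "\<lambda>n. d (\<sigma> n) (\<tau> n) - d (\<sigma>' n) (\<tau>' n)" 0] by simp
qed

lemma Metric_space_completion: "Metric_space CC CD"
proof
  show "0 \<le> CD S T" for S T
  proof (cases "S \<in> CC \<and> T \<in> CC")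
    case True
    then obtain \<sigma> \<tau> where *: "MCauchy \<sigma>" "S = cclass \<sigma>" "MCauchy \<tau>" "T = cclass \<tau>"
      by (metis completion_carrierE)
    then show ?thesis
      using tendsto_completion_dist[of \<sigma> \<tau>] by (auto intro: LIMSEQ_le_const)
  qed (auto simp: completion_dist_def)
  show "CD S T = CD T S" for S T
    by (simp add: completion_dist_def commute conj_commute)
next
  fix S T assume "S \<in> CC" "T \<in> CC"
  then obtain \<sigma> \<tau> where *: "MCauchy \<sigma>" "S = cclass \<sigma>" "MCauchy \<tau>" "T = cclass \<tau>"
    by (metis completion_carrierE)
  then show "CD S T = 0 \<longleftrightarrow> S = T"
    using tendsto_completion_dist[of \<sigma> \<tau>] cclass_eq_iff[of \<sigma> \<tau>] LIMSEQ_unique by force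
next
  fix S T U assume "S \<in> CC" "T \<in> CC" "U \<in> CC"
  then obtain \<sigma> \<tau> \<upsilon> where *: "MCauchy \<sigma>" "S = cclass \<sigma>" "MCauchy \<tau>" "T = cclass \<tau>"
     "MCauchy \<upsilon>" "U = cclass \<upsilon>"
    by (metis completion_carrierE)
  have "CD (cclass \<sigma>) (cclass \<upsilon>) \<le> CD (cclass \<sigma>) (cclass \<tau>) + CD (cclass \<tau>) (cclass \<upsilon>)"
    by (rule LIMSEQ_le[OF tendsto_completion_dist tendsto_add[OF tendsto_completion_dist tendsto_completion_dist]])
      (use * in \<open>auto intro: triangle MCauchyD\<close>)
  then show "CD S U \<le> CD S T + CD T U" using * by simp
qed

lemma completion_embed_in: "p \<in> M \<Longrightarrow> completion_embed M d p \<in> CC"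
  by (simp add: completion_embed_def)

lemma tendsto_dist_completion_embed:
  assumes "MCauchy \<sigma>" "p \<in> M"
  shows "(\<lambda>n. d (\<sigma> n) p) \<longlonglongrightarrow> CD (cclass \<sigma>) (completion_embed M d p)"
  using tendsto_completion_dist[of \<sigma> "\<lambda>_. p"] assms by (simp add: completion_embed_def)

lemma completion_dist_embed:
  assumes "p \<in> M" "q \<in> M"
  shows "CD (completion_embed M d p) (completion_embed M d q) = d p q"
  using tendsto_completion_dist[of "\<lambda>_. p" "\<lambda>_. q"] assms
  by (simp add: completion_embed_def LIMSEQ_const_iff)

lemma MCauchy_approximates_class:
  assumes \<sigma>: "MCauchy \<sigma>" and "0 < e"
  shows "\<exists>N. \<forall>n\<ge>N. CD (cclass \<sigma>) (completion_embed M d (\<sigma> n)) \<le> e"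
proof -
  obtain N where N: "\<And>m n. N \<le> m \<Longrightarrow> N \<le> n \<Longrightarrow> d (\<sigma> m) (\<sigma> n) < e"
    using \<sigma> \<open>0 < e\<close> unfolding MCauchy_def by meson
  have "CD (cclass \<sigma>) (completion_embed M d (\<sigma> n)) \<le> e" if "n \<ge> N" for n
    by (rule LIMSEQ_le_const2[OF tendsto_dist_completion_embed[OF \<sigma> MCauchyD[OF \<sigma>]]])
      (use N that in \<open>auto intro!: exI[of _ N] less_imp_le\<close>)
  then show ?thesis by blast
qed

lemma completion_embed_dense:
  assumes "S \<in> CC" "0 < e"
  shows "\<exists>p\<in>M. CD S (completion_embed M d p) < e"
proof -
  obtain \<sigma> where \<sigma>: "MCauchy \<sigma>" "S = cclass \<sigma>" using assms completion_carrierE by blast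
  obtain N where "\<forall>n\<ge>N. CD S (completion_embed M d (\<sigma> n)) \<le> e/2"
    using MCauchy_approximates_class[OF \<sigma>(1), of "e/2"] assms \<sigma> by auto
  then have "CD S (completion_embed M d (\<sigma> N)) < e"
    using \<open>0 < e\<close> by force
  then show ?thesis using MCauchyD \<sigma> by blast
qed

text \<open>Approximate the n-th class by an embedded point \<open>p n\<close> of the original space
  up to 1/(n+1). Then \<open>p\<close> is a Cauchy sequence there, and its class is the
  limit.\<close>

lemma mcomplete_completion: "Metric_space.mcomplete CC CD"
proof -
  interpret C: Metric_space CC CD by (rule Metric_space_completion)
  let ?i = "completion_embed M d"
  show ?thesis
    unfolding C.mcomplete_def
  proof (intro allI impI)
    fix S assume S: "C.MCauchy S"
    then have SC: "S n \<in> CC" for n by (auto simp: C.MCauchy_def)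
    have "\<exists>p\<in>M. CD (S n) (?i p) < inverse (real (Suc n))" for n
      using completion_embed_dense SC by simp
    then obtain p where p: "\<And>n. p n \<in> M" "\<And>n. CD (S n) (?i (p n)) < inverse (real (Suc n))"
      by metis
    have near: "\<exists>N. \<forall>n\<ge>N. CD (S n) (?i (p n)) < e" if "0 < e" for e
    proof -
      obtain N where N: "inverse (real (Suc N)) < e" using reals_Archimedean \<open>0 < e\<close> by blast
      have "CD (S n) (?i (p n)) < e" if "n \<ge> N" for n
      proof -
        have "inverse (real (Suc n)) \<le> inverse (real (Suc N))" using that by simp
        then show ?thesis using p(2)[of n] N by linarith
      qed
      then show ?thesis by blast
    qed
    have pC: "MCauchy p"
      unfolding MCauchy_def
    proof (intro conjI allI impI)
      show "range p \<subseteq> M" using p by auto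
      fix e :: real assume "0 < e"
      then have "0 < e/3" by simp
      obtain N where N: "\<And>m n. N \<le> m \<Longrightarrow> N \<le> n \<Longrightarrow> CD (S m) (S n) < e/3"
        using S \<open>0 < e/3\<close> unfolding C.MCauchy_def by meson
      obtain N' where N': "\<forall>n\<ge>N'. CD (S n) (?i (p n)) < e/3" using near \<open>0 < e/3\<close> by meson
      show "\<exists>N. \<forall>n n'. N \<le> n \<longrightarrow> N \<le> n' \<longrightarrow> d (p n) (p n') < e"
      proof (intro exI[of _ "max N N'"] allI impI)
        fix m n assume mn: "max N N' \<le> m" "max N N' \<le> n"
        have "d (p m) (p n) = CD (?i (p m)) (?i (p n))" using p by (simp add: completion_dist_embed)
        also have "\<dots> \<le> CD (S m) (?i (p m)) + CD (S m) (S n) + CD (S n) (?i (p n))"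
          using C.triangle[of "?i (p m)" "S m" "?i (p n)"] C.triangle[of "S m" "S n" "?i (p n)"]
          by (simp add: SC p completion_embed_in C.commute)
        also have "\<dots> < e/3 + e/3 + e/3"
          using N N' mn by (intro add_strict_mono) auto
        finally show "d (p m) (p n) < e" by simp
      qed
    qed
    have "limitin C.mtopology S (cclass p) sequentially"
      unfolding C.limit_metric_sequentially
    proof (intro conjI allI impI)
      show "cclass p \<in> CC" using pC by simp
      fix e :: real assume "0 < e"
      then have "0 < e/2" by simp
      obtain N where N: "\<forall>n\<ge>N. CD (S n) (?i (p n)) < e/2" using near \<open>0 < e/2\<close> by meson
      obtain N' where N': "\<forall>n\<ge>N'. CD (cclass p) (?i (p n)) \<le> e/2"
        using MCauchy_approximates_class[OF pC \<open>0 < e/2\<close>] by blast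
      show "\<exists>N. \<forall>n\<ge>N. S n \<in> CC \<and> CD (S n) (cclass p) < e"
      proof (intro exI[of _ "max N N'"] allI impI conjI SC)
        fix n assume n: "max N N' \<le> n"
        have "CD (S n) (cclass p) \<le> CD (S n) (?i (p n)) + CD (cclass p) (?i (p n))"
          using C.triangle[of "S n" "?i (p n)" "cclass p"] pC p SC
          by (simp add: completion_embed_in C.commute)
        also have "\<dots> < e/2 + e/2"
          using N N' n by (intro add_less_le_mono) auto
        finally show "CD (S n) (cclass p) < e" by simp
      qed
    qed
    then show "\<exists>x. limitin C.mtopology S x sequentially" by blast
  qed
qed

text \<open>Each end of a distance is moved by at most \<epsilon>/2. The relation is written out,
  instead of being asserted to exist, so that a pair of base points can be checked to belong to
  it.\<close>

lemma correspondence_dense_isometry: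
  assumes N: "Metric_space N e" and f: "f ` M \<subseteq> N" "\<And>u v. u \<in> M \<Longrightarrow> v \<in> M \<Longrightarrow> e (f u) (f v) = d u v"
    and dense: "\<And>z \<delta>. z \<in> N \<Longrightarrow> 0 < \<delta> \<Longrightarrow> \<exists>u\<in>M. e z (f u) < \<delta>" and "0 < \<epsilon>"
  shows "correspondence \<epsilon> M d N e {(u, z). u \<in> M \<and> z \<in> N \<and> e z (f u) \<le> \<epsilon> / 2}"
proof (rule correspondenceI)
  interpret N: Metric_space N e by fact
  show "\<exists>v. (u, v) \<in> {(u, z). u \<in> M \<and> z \<in> N \<and> e z (f u) \<le> \<epsilon> / 2}" if "u \<in> M" for u
    using that f \<open>0 < \<epsilon>\<close> by (intro exI[of _ "f u"]) auto
  show "\<exists>u. (u, v) \<in> {(u, z). u \<in> M \<and> z \<in> N \<and> e z (f u) \<le> \<epsilon> / 2}" if "v \<in> N" for v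
    using dense[OF that, of "\<epsilon>/2"] that \<open>0 < \<epsilon>\<close> by force
  fix u v u' v'
  assume "(u, v) \<in> {(u, z). u \<in> M \<and> z \<in> N \<and> e z (f u) \<le> \<epsilon> / 2}"
    "(u', v') \<in> {(u, z). u \<in> M \<and> z \<in> N \<and> e z (f u) \<le> \<epsilon> / 2}"
  then have *: "u \<in> M" "u' \<in> M" "v \<in> N" "v' \<in> N" "f u \<in> N" "f u' \<in> N" "e v (f u) \<le> \<epsilon>/2" "e v' (f u') \<le> \<epsilon>/2"
    using f by auto
  then show "\<bar>d u u' - e v v'\<bar> \<le> \<epsilon>"
    using f(2)[of u u'] N.triangle[of "f u" v "f u'"] N.triangle[of v v' "f u'"]
       N.triangle[of v "f u" v'] N.triangle[of "f u" "f u'" v']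
    by (simp add: N.commute abs_le_iff)
qed auto

text \<open>Limits in \<open>gh_precompact\<close> have their points in \<open>real\<close>. Total
  boundedness gives separability, and separability bounds the cardinality by that of the
  continuum.\<close>

lemma mtotally_bounded_imp_inj_on_real:
  assumes "mtotally_bounded M"
  shows "\<exists>h :: 'a \<Rightarrow> real. inj_on h M"
proof -
  have "\<exists>N. finite N \<and> N \<subseteq> M \<and> (\<forall>u\<in>M. \<exists>v\<in>N. d v u < inverse (real (Suc k)))" for k
    using assms unfolding mtotally_bounded_space by simp
  then obtain N where N: "\<And>k. finite (N k)" "\<And>k. N k \<subseteq> M"
      "\<And>k u. u \<in> M \<Longrightarrow> \<exists>v\<in>N k. d v u < inverse (real (Suc k))"
    by metis
  define S where "S = (\<Union>k. N k)"
  have "countable S" unfolding S_def using N by (auto intro: countable_finite)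
  \<comment> \<open>A point is determined by the set of pairs $(i,m)$ such that it is $1/(m+1)$-close to the $i$-th
    point of a countable dense set.\<close>
  define c where "c u = {n. d (from_nat_into S (fst (prod_decode n))) u < inverse (real (Suc (snd (prod_decode n))))}" for u
  have "inj_on c M"
  proof (rule inj_onI, rule ccontr)
    fix u v assume uv: "u \<in> M" "v \<in> M" "c u = c v" "u \<noteq> v"
    then have "0 < d u v / 2" by simp
    then obtain m where m: "inverse (real (Suc m)) < d u v / 2" using reals_Archimedean by blast
    obtain s where s: "s \<in> N m" "d s u < inverse (real (Suc m))" using N uv by blast
    then have "s \<in> S" "s \<in> M" using N by (auto simp: S_def)
    then obtain i where i: "from_nat_into S i = s"
      using \<open>countable S\<close> from_nat_into_surj by metis
    have "prod_encode (i, m) \<in> c u" using s i by (simp add: c_def)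
    then have "prod_encode (i, m) \<in> c v" using uv by simp
    then have "d s v < inverse (real (Suc m))" using i by (simp add: c_def)
    then show False
      using triangle[of u s v] uv \<open>s \<in> M\<close> s m by (simp add: commute)
  qed
  moreover obtain g :: "nat set \<Rightarrow> real" where "inj g"
    using eqpoll_imp_lepoll[OF nat_sets_eqpoll_reals] unfolding lepoll_def by blast
  ultimately have "inj_on (g \<circ> c) M"
    by (meson comp_inj_on inj_on_subset subset_UNIV)
  then show ?thesis by blast
qed

text \<open>The metric is pulled back along the inverse of an injection into \<open>real\<close>.
  Compactness is transferred in two halves: completeness through the bijection, total boundedness
  through the correspondences.\<close>

lemma compact_real_copy:
  assumes "compact_space mtopology"
  shows "\<exists>(K :: real set) dK. Metric_space K dK \<and> compact_space (Metric_space.mtopology K dK) \<and>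
     (\<forall>\<epsilon>>0. \<exists>R. correspondence \<epsilon> M d K dK R)"
proof -
  have tb: "mtotally_bounded M" and mc: "mcomplete"
    using assms by (simp_all add: compact_space_eq_mcomplete_mtotally_bounded)
  obtain h :: "'a \<Rightarrow> real" where h: "inj_on h M"
    using mtotally_bounded_imp_inj_on_real[OF tb] by blast
  define g where "g = inv_into M h"
  define dK where "dK a b = d (g a) (g b)" for a b
  have gh: "g (h u) = u" if "u \<in> M" for u using h that by (simp add: g_def)
  have g: "g a \<in> M" "h (g a) = a" if "a \<in> h ` M" for a
    using that by (simp_all add: g_def inv_into_into f_inv_into_f)
  have K: "Metric_space (h ` M) dK"
  proof
    show "(dK a b = 0) = (a = b)" if "a \<in> h ` M" "b \<in> h ` M" for a b
      using that gh by (auto simp: dK_def)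
    show "dK a c \<le> dK a b + dK b c" if "a \<in> h ` M" "b \<in> h ` M" "c \<in> h ` M" for a b c
      using that g by (simp add: dK_def triangle)
  qed (simp_all add: dK_def commute)
  interpret K: Metric_space "h ` M" dK by fact
  have R: "\<exists>R. correspondence \<epsilon> M d (h ` M) dK R" if "0 < \<epsilon>" for \<epsilon>
  proof
    show "correspondence \<epsilon> M d (h ` M) dK {(u, z). u \<in> M \<and> z \<in> h ` M \<and> dK z (h u) \<le> \<epsilon> / 2}"
      by (rule correspondence_dense_isometry[OF K]) (use that gh in \<open>auto simp: dK_def intro: bexI[rotated]\<close>)
  qed
  have "K.mcomplete"
    unfolding K.mcomplete_def
  proof (intro allI impI)
    fix \<sigma> assume \<sigma>: "K.MCauchy \<sigma>"
    then have "MCauchy (g \<circ> \<sigma>)"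
      using g by (auto simp: K.MCauchy_def MCauchy_def dK_def image_subset_iff)
    then obtain z where z: "limitin mtopology (g \<circ> \<sigma>) z sequentially"
      using mc by (auto simp: mcomplete_def)
    have "\<sigma> n \<in> h ` M" for n using \<sigma> by (auto simp: K.MCauchy_def)
    then have "dK (\<sigma> n) (h z) = d (g (\<sigma> n)) z" for n
      using z gh by (simp add: dK_def limit_metric_sequentially)
    with z \<open>\<And>n. \<sigma> n \<in> h ` M\<close> have "limitin K.mtopology \<sigma> (h z) sequentially"
      unfolding K.limitin_metric limitin_metric comp_apply by (auto elim: eventually_mono)
    then show "\<exists>x. limitin K.mtopology \<sigma> x sequentially" by blast
  qed
  moreover have "K.mtotally_bounded (h ` M)"
    by (rule mtotally_bounded_correspondence[OF Metric_space_axioms K tb R])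
  ultimately have "compact_space K.mtopology"
    by (simp add: K.compact_space_eq_mcomplete_mtotally_bounded)
  then show ?thesis using K R by blast
qed

lemma correspondence_completion:
  assumes "0 < \<epsilon>" shows "\<exists>R. correspondence \<epsilon> M d CC CD R"
  using correspondence_dense_isometry[OF Metric_space_completion _ completion_dist_embed completion_embed_dense assms]
    completion_embed_in by blast

text \<open>An open ball need not be compact, but its completion is as soon as it is totally
  bounded, and correspondences do not notice the passage to the completion.\<close>

lemma mtotally_bounded_compact_model:
  assumes "mtotally_bounded M"
  shows "\<exists>(K :: real set) dK. Metric_space K dK \<and> compact_space (Metric_space.mtopology K dK) \<and>
     (\<forall>\<epsilon>>0. \<exists>R. correspondence \<epsilon> M d K dK R)"
proof -
  interpret C: Metric_space CC CD by (rule Metric_space_completion)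
  have "C.mtotally_bounded CC"
    by (rule mtotally_bounded_correspondence[OF Metric_space_axioms C.Metric_space_axioms assms correspondence_completion])
  then have "compact_space C.mtopology"
    by (simp add: C.compact_space_eq_mcomplete_mtotally_bounded mcomplete_completion)
  then obtain K :: "real set" and dK where K: "Metric_space K dK" "compact_space (Metric_space.mtopology K dK)"
    "\<And>\<epsilon>. 0 < \<epsilon> \<Longrightarrow> \<exists>R. correspondence \<epsilon> CC CD K dK R"
    using C.compact_real_copy by blast
  have "\<exists>R. correspondence \<epsilon> M d K dK R" if "0 < \<epsilon>" for \<epsilon>
  proof -
    have "0 < \<epsilon>/2" using that by simp
    then obtain R R' where "correspondence (\<epsilon>/2) M d CC CD R" "correspondence (\<epsilon>/2) CC CD K dK R'"
      using K(3) correspondence_completion by meson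
    then have "correspondence (\<epsilon>/2 + \<epsilon>/2) M d K dK (R O R')" by (rule correspondence_comp)
    then show ?thesis by auto
  qed
  then show ?thesis using K by blast
qed

end

section \<open>Uniqueness of the limit\<close>

text \<open>The closures of the tails are nested nonempty closed sets in a compact space. A cluster
  point is used instead of a convergent subsequence because a product over an uncountable index set
  need not be sequentially compact.\<close>

lemma compactin_cluster_point:
  assumes "compactin X K" "range \<sigma> \<subseteq> K"
  shows "\<exists>z\<in>K. \<forall>U. openin X U \<and> z \<in> U \<longrightarrow> (\<forall>N. \<exists>n\<ge>N::nat. \<sigma> n \<in> U)"
proof -
  define C where "C N = subtopology X K closure_of (\<sigma> ` {N..})" for N
  have KX: "K \<subseteq> topspace X" using assms(1) by (simp add: compactin_subset_topspace)
  have sub: "\<sigma> ` {N..} \<subseteq> C N" for N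
    unfolding C_def using assms KX by (intro closure_of_subset) auto
  have "(\<Inter>N. C N) \<noteq> {}"
  proof (rule compact_space_imp_nest)
    show "compact_space (subtopology X K)" using assms(1) by (simp add: compact_space_subtopology)
    show "C N \<noteq> {}" for N using sub[of N] by auto
    show "decseq C" unfolding C_def by (intro decseq_SucI closure_of_mono image_mono) auto
  qed (simp add: C_def)
  then obtain z where z: "\<And>N. z \<in> C N" by blast
  show ?thesis
  proof (intro bexI allI impI)
    show "z \<in> K" using z[of 0] by (auto simp: C_def in_closure_of)
    fix U N assume U: "openin X U \<and> z \<in> U"
    then have "openin (subtopology X K) (K \<inter> U)" by (simp add: openin_subtopology_Int2)
    moreover have "z \<in> K \<inter> U" using U \<open>z \<in> K\<close> by simp
    ultimately obtain y where "y \<in> \<sigma> ` {N..}" "y \<in> K \<inter> U"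
      using z[of N] unfolding C_def in_closure_of by blast
    then show "\<exists>n\<ge>N. \<sigma> n \<in> U" by auto
  qed
qed

lemma (in Metric_space) compactin_mcball_if_mtotally_bounded:
  assumes "mcomplete" "\<And>r. 0 < r \<Longrightarrow> mtotally_bounded (mball a r)"
  shows "compactin mtopology (mcball a r)"
proof -
  \<comment> \<open>The radius \<bar>r\<bar> + 1 is positive also when \<open>r\<close> is not, as
    the hypothesis requires.\<close>
  have "mcball a r \<subseteq> mball a (\<bar>r\<bar> + 1)"
    by auto
  then have "mtotally_bounded (mcball a r)"
    using mtotally_bounded_subset[OF assms(2)[of "\<bar>r\<bar> + 1"]] by simp
  then show ?thesis
    using assms(1) mtotally_bounded_eq_compact_closure_of[of "mcball a r"]
    by (simp add: closure_of_closedin)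
qed

text \<open>The correspondences give almost inverse maps $F_n$ and $G_n$, which satisfy
  $d(F_n u, s) \approx d(u, G_n s)$. By Tychonoff's theorem the pairs $(F_n, G_n)$ have a cluster
  point $(f, g)$, and the exact equation $d(f u, s) = d(u, g s)$ makes \<open>f\<close> an isometry with
  inverse \<open>g\<close>.\<close>

lemma pointed_isometric_if_correspondences:
  assumes Y: "Metric_space Y dY" and T: "Metric_space T dT"
    and Yc: "Metric_space.mcomplete Y dY" and Tc: "Metric_space.mcomplete T dT"
    and y: "y \<in> Y" and ap: "ap \<in> T"
    and Tb: "\<And>r. 0 < r \<Longrightarrow> Metric_space.mtotally_bounded T dT (Metric_space.mball T dT ap r)"
    and R: "\<And>r \<epsilon>. 0 < r \<Longrightarrow> 0 < \<epsilon> \<Longrightarrow> \<exists>R. correspondence \<epsilon> (Metric_space.mball Y dY y r) dY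
              (Metric_space.mball T dT ap r) dT R \<and> (y, ap) \<in> R"
  shows "pointed_isometric Y dY y T dT ap"
proof -
  interpret Y: Metric_space Y dY by fact
  interpret T: Metric_space T dT by fact
  \<comment> \<open>The correspondences carry total boundedness from the balls of \<open>T\<close>
    to those of \<open>Y\<close>. Together with completeness this makes the closed balls of both
    spaces compact.\<close>
  have Yb: "Y.mtotally_bounded (Y.mball y r)" if "0 < r" for r
  proof -
    have "Metric_space.mtotally_bounded (Y.mball y r) dY (Y.mball y r)"
    proof (rule mtotally_bounded_correspondence)
      show "Metric_space (T.mball ap r) dT" "Metric_space (Y.mball y r) dY"
        by (auto intro: T.subspace Y.subspace)
      show "Metric_space.mtotally_bounded (T.mball ap r) dT (T.mball ap r)"
        using Tb[OF that] T.mtotally_bounded_absolute by blast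
      show "\<exists>R. correspondence \<epsilon> (T.mball ap r) dT (Y.mball y r) dY R" if "0 < \<epsilon>" for \<epsilon>
        using R[OF \<open>0 < r\<close> that] correspondence_converse by blast
    qed
    then show ?thesis using Y.mtotally_bounded_absolute Y.mball_subset_mspace by blast
  qed
  define e where "e n = inverse (real (Suc n))" for n
  have e: "0 < e n" "e n \<le> 1" for n by (auto simp: e_def divide_simps)
  \<comment> \<open>The radii grow while the errors \<open>e n\<close> shrink, so every point
    eventually lies in the ball and is matched with vanishing error.\<close>
  define BY BT where "BY n = Y.mball y (real (Suc n))" and "BT n = T.mball ap (real (Suc n))" for n
  have "\<exists>R. correspondence (e n) (BY n) dY (BT n) dT R \<and> (y, ap) \<in> R" for n
    using R[of "real (Suc n)" "e n"] e[of n] by (simp add: BY_def BT_def)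
  then obtain R where R: "\<And>n. correspondence (e n) (BY n) dY (BT n) dT (R n)" "\<And>n. (y, ap) \<in> R n"
    by metis
  note RD = correspondenceD[OF R(1)]
  \<comment> \<open>Outside the ball the default is the base point. With it the bound
    \<open>Fo\<close> holds for every \<open>n\<close>, and hence all values at a fixed
    \<open>u\<close> lie in one compact ball; likewise for \<open>G\<close>.\<close>
  define F where "F n u = (if u \<in> BY n then SOME s. (u, s) \<in> R n else ap)" for n u
  define G where "G n s = (if s \<in> BT n then SOME u. (u, s) \<in> R n else y)" for n s
  have F: "(u, F n u) \<in> R n" if "u \<in> BY n" for n u
    using RD(3)[OF that] that unfolding F_def by (auto intro: someI_ex)
  have G: "(G n s, s) \<in> R n" if "s \<in> BT n" for n s
    using RD(4)[OF that] that unfolding G_def by (auto intro: someI_ex)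
  have adj: "\<bar>dT (F n u) s - dY u (G n s)\<bar> \<le> e n" if "u \<in> BY n" "s \<in> BT n" for n u s
    using RD(5)[OF F[OF that(1)] G[OF that(2)]] by (simp add: abs_minus_commute)
  have Fo: "dT ap (F n u) \<le> dY y u + e n" if "u \<in> Y" for n u
  proof (cases "u \<in> BY n")
    case True
    then show ?thesis using RD(5)[OF R(2) F[OF True]] by (simp add: abs_le_iff)
  next
    case False
    then show ?thesis using ap e(1)[of n] by (simp add: F_def add_nonneg_nonneg less_imp_le)
  qed
  have Gy: "dY y (G n s) \<le> dT ap s + e n" if "s \<in> T" for n s
  proof (cases "s \<in> BT n")
    case True
    then show ?thesis using RD(5)[OF R(2) G[OF True]] by (simp add: abs_le_iff)
  next
    case False
    then show ?thesis using y e(1)[of n] by (simp add: G_def add_nonneg_nonneg less_imp_le)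
  qed
  have FT: "F n u \<in> T" for n u
    using RD(2)[OF F[of u n]] ap by (cases "u \<in> BY n") (auto simp: BT_def F_def)
  have GY: "G n s \<in> Y" for n s
    using RD(1)[OF G[of s n]] y by (cases "s \<in> BT n") (auto simp: BY_def G_def)
  define XF where "XF = product_topology (\<lambda>_. T.mtopology) Y"
  define XG where "XG = product_topology (\<lambda>_. Y.mtopology) T"
  \<comment> \<open>The summand 1 in the radii is the bound on \<open>e n\<close>, uniform in
    \<open>n\<close>.\<close>
  define KF where "KF = (\<Pi>\<^sub>E u\<in>Y. T.mcball ap (dY y u + 1))"
  define KG where "KG = (\<Pi>\<^sub>E s\<in>T. Y.mcball y (dT ap s + 1))"
  have "compactin (prod_topology XF XG) (KF \<times> KG)"
    unfolding compactin_Times XF_def XG_def KF_def KG_def compactin_PiE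
    using T.compactin_mcball_if_mtotally_bounded[OF Tc Tb] Y.compactin_mcball_if_mtotally_bounded[OF Yc Yb]
    by simp
  moreover have "range (\<lambda>n. (restrict (F n) Y, restrict (G n) T)) \<subseteq> KF \<times> KG"
    using ap y FT GY order_trans[OF Fo add_left_mono[OF e(2)]] order_trans[OF Gy add_left_mono[OF e(2)]]
    by (auto simp: KF_def KG_def)
  ultimately obtain f g where fg: "(f, g) \<in> KF \<times> KG"
    and cluster: "\<And>U N. openin (prod_topology XF XG) U \<Longrightarrow> (f, g) \<in> U \<Longrightarrow>
        \<exists>n\<ge>N. (restrict (F n) Y, restrict (G n) T) \<in> U"
    using compactin_cluster_point[of "prod_topology XF XG" "KF \<times> KG" "\<lambda>n. (restrict (F n) Y, restrict (G n) T)"]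
    by (metis (no_types, lifting) surj_pair)
  have f: "f u \<in> T" if "u \<in> Y" for u using fg that by (auto simp: KF_def PiE_iff)
  have g: "g s \<in> Y" if "s \<in> T" for s using fg that by (auto simp: KG_def PiE_iff)
  \<comment> \<open>A neighbourhood in the product controls finitely many coordinates; one
    coordinate of each factor is enough for an equation in \<open>u\<close> and \<open>s\<close>.
    Taking both from one cluster point of pairs ensures that the same \<open>n\<close> serves
    \<open>F\<close> and \<open>G\<close>.\<close>
  have near: "\<exists>n\<ge>N. dT (f u) (F n u) < \<epsilon> \<and> dY (g s) (G n s) < \<epsilon>" if us: "u \<in> Y" "s \<in> T" and "0 < \<epsilon>" for N u s \<epsilon>
  proof -
    let ?U = "{h \<in> topspace XF. h u \<in> T.mball (f u) \<epsilon>}" and ?V = "{h \<in> topspace XG. h s \<in> Y.mball (g s) \<epsilon>}"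
    have "openin XF ?U" unfolding XF_def
      by (rule openin_continuous_map_preimage[OF continuous_map_product_projection[of u Y "\<lambda>_. T.mtopology"] T.openin_mball]) (rule us)
    moreover have "openin XG ?V" unfolding XG_def
      by (rule openin_continuous_map_preimage[OF continuous_map_product_projection[of s T "\<lambda>_. Y.mtopology"] Y.openin_mball]) (rule us)
    ultimately have "openin (prod_topology XF XG) (?U \<times> ?V)" by (simp add: openin_prod_Times_iff)
    moreover have "(f, g) \<in> ?U \<times> ?V"
      using fg f g us \<open>0 < \<epsilon>\<close> by (auto simp: XF_def XG_def KF_def KG_def PiE_iff)
    ultimately show ?thesis
      using cluster[of "?U \<times> ?V" N] us by (auto simp: less_imp_le)
  qed
  have small: "\<exists>N. \<forall>n\<ge>N. e n < \<epsilon> \<and> u \<in> BY n \<and> s \<in> BT n" if us: "u \<in> Y" "s \<in> T" and "0 < \<epsilon>" for u s \<epsilon>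
  proof -
    have "e \<longlonglongrightarrow> 0" unfolding e_def by (rule LIMSEQ_inverse_real_of_nat)
    then have "eventually (\<lambda>n. e n < \<epsilon>) sequentially" using \<open>0 < \<epsilon>\<close> by (rule order_tendstoD)
    then obtain N1 where N1: "\<And>n. n \<ge> N1 \<Longrightarrow> e n < \<epsilon>" by (auto simp: eventually_sequentially)
    obtain N2 where N2: "dY y u + dT ap s < real N2" using reals_Archimedean2 by blast
    have "u \<in> BY n" "s \<in> BT n" if "n \<ge> N2" for n
    proof -
      have "dY y u + dT ap s < real (Suc n)" using N2 that by linarith
      then show "u \<in> BY n" "s \<in> BT n"
        using us y ap Y.nonneg[of y u] T.nonneg[of ap s] unfolding BY_def BT_def
        by (auto simp del: Y.nonneg T.nonneg of_nat_Suc)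
    qed
    then show ?thesis using N1 by (intro exI[of _ "max N1 N2"]) auto
  qed
  have eq: "dT (f u) s = dY u (g s)" if us: "u \<in> Y" "s \<in> T" for u s
  proof -
    have "\<bar>dT (f u) s - dY u (g s)\<bar> \<le> \<delta>" if "0 < \<delta>" for \<delta>
    proof -
      have "0 < \<delta>/3" using that by simp
      obtain N where N: "\<forall>n\<ge>N. e n < \<delta>/3 \<and> u \<in> BY n \<and> s \<in> BT n" using small[OF us \<open>0 < \<delta>/3\<close>] by blast
      obtain n where n: "n \<ge> N" "dT (f u) (F n u) < \<delta>/3" "dY (g s) (G n s) < \<delta>/3"
        using near[OF us \<open>0 < \<delta>/3\<close>] by blast
      have "\<bar>dT (F n u) s - dY u (G n s)\<bar> < \<delta>/3"
        using adj[of u n s] N n by fastforce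
      moreover have "\<bar>dT (f u) s - dT (F n u) s\<bar> \<le> dT (f u) (F n u)"
        using T.mdist_reverse_triangle[of "f u" s "F n u"] f us FT by (simp add: T.commute)
      moreover have "\<bar>dY u (g s) - dY u (G n s)\<bar> \<le> dY (g s) (G n s)"
        using Y.mdist_reverse_triangle[of "g s" u "G n s"] g us GY by (simp add: Y.commute)
      ultimately show ?thesis using n by linarith
    qed
    then have "\<bar>dT (f u) s - dY u (g s)\<bar> \<le> 0" by (rule field_le_epsilon[of _ 0, simplified add_0])
    then show ?thesis by simp
  qed
  \<comment> \<open>With s = f u the left side of \<open>eq\<close> vanishes, so \<open>u\<close>
    and \<open>g (f u)\<close> are at distance 0.\<close>
  have gf: "g (f u) = u" if "u \<in> Y" for u
    using eq[OF that f[OF that]] f g that by simp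
  have fg': "f (g s) = s" if "s \<in> T" for s
    using eq[OF g[OF that] that] f g that by simp
  \<comment> \<open>By \<open>Fo\<close> at \<open>y\<close> itself, \<open>F n y\<close> is within
    \<open>e n\<close> of \<open>ap\<close>.\<close>
  have "f y = ap"
  proof -
    have "dT ap (f y) \<le> \<delta>" if "0 < \<delta>" for \<delta>
    proof -
      have "0 < \<delta>/2" using that by simp
      obtain N where N: "\<forall>n\<ge>N. e n < \<delta>/2 \<and> y \<in> BY n \<and> ap \<in> BT n" using small[OF y ap \<open>0 < \<delta>/2\<close>] by blast
      obtain n where n: "n \<ge> N" "dT (f y) (F n y) < \<delta>/2"
        using near[OF y ap \<open>0 < \<delta>/2\<close>] by blast
      have "dT ap (F n y) < \<delta>/2" using Fo[OF y, of n] N n y by fastforce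
      then show ?thesis using T.triangle'[of ap "F n y" "f y"] n ap f[OF y] FT by auto
    qed
    then have "dT ap (f y) \<le> 0" by (rule field_le_epsilon[of _ 0, simplified add_0])
    then have "dT ap (f y) = 0" using T.nonneg[of ap "f y"] by linarith
    then show ?thesis using ap f[OF y] by simp
  qed
  \<comment> \<open>Apply \<open>eq\<close> to \<open>u\<close> and s = f v and cancel
    \<open>g (f v)\<close>.\<close>
  moreover have "isometric_embedding Y dY T dT f"
    unfolding isometric_embedding_def using f eq gf by (auto simp: image_subset_iff)
  moreover have "f ` Y = T"
    using f g fg' by (auto simp: image_iff) metis
  ultimately show ?thesis unfolding pointed_isometric_def by blast
qed

section \<open>The tangent cone\<close>

text \<open>Zorn's lemma for the extensions of \<gamma>. Any two parameters in the union of a chain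
  lie in the domain of a single member, so the unit speed condition survives the union.\<close>

lemma maximal_ray_extension:
  assumes \<gamma>: "unit_speed_geodesic x \<gamma>"
  shows "\<exists>\<zeta>\<in>maximal_rays x. \<gamma> \<subseteq>\<^sub>m \<zeta>"
proof -
  define A where "A = {\<eta>. unit_speed_geodesic x \<eta> \<and> \<gamma> \<subseteq>\<^sub>m \<eta>}"
  have "\<exists>m\<in>A. \<forall>\<eta>\<in>A. m \<subseteq>\<^sub>m \<eta> \<longrightarrow> \<eta> = m"
  proof (rule predicate_Zorn)
    show "partial_order_on A (relation_of (\<subseteq>\<^sub>m) A)"
      by (rule partial_order_on_relation_ofI) (auto intro: map_le_trans map_le_antisym)
  next
    fix C assume C: "C \<in> Chains (relation_of (\<subseteq>\<^sub>m) A)"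
    then have CA: "\<eta> \<in> A" if "\<eta> \<in> C" for \<eta>
      using that by (auto simp: Chains_def relation_of_def)
    have chain: "\<eta> \<subseteq>\<^sub>m \<eta>' \<or> \<eta>' \<subseteq>\<^sub>m \<eta>" if "\<eta> \<in> C" "\<eta>' \<in> C" for \<eta> \<eta>'
      using that C by (auto simp: Chains_def relation_of_def)
    show "\<exists>u\<in>A. \<forall>\<eta>\<in>C. \<eta> \<subseteq>\<^sub>m u"
    proof (cases "C = {}")
      case True
      then show ?thesis using \<gamma> by (auto simp: A_def)
    next
      case False
      \<comment> \<open>The union of the chain as a partial map. The choice is harmless because
        members of a chain agree wherever both are defined.\<close>
      define u where "u t = (if \<exists>\<eta>\<in>C. t \<in> dom \<eta> then (SOME \<eta>. \<eta> \<in> C \<and> t \<in> dom \<eta>) t else None)" for t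
      have u: "u t = \<eta> t" if "\<eta> \<in> C" "t \<in> dom \<eta>" for \<eta> t
      proof -
        let ?\<xi> = "SOME \<eta>. \<eta> \<in> C \<and> t \<in> dom \<eta>"
        have \<xi>: "?\<xi> \<in> C \<and> t \<in> dom ?\<xi>" by (rule someI[of _ \<eta>]) (use that in simp)
        have "u t = ?\<xi> t" using that by (auto simp: u_def)
        also have "\<dots> = \<eta> t"
          using chain[OF that(1) conjunct1[OF \<xi>]]
        proof
          assume "\<eta> \<subseteq>\<^sub>m ?\<xi>"
          then show ?thesis using that(2) by (simp add: map_le_def)
        next
          assume "?\<xi> \<subseteq>\<^sub>m \<eta>"
          then show ?thesis using conjunct2[OF \<xi>] by (simp add: map_le_def)
        qed
        finally show ?thesis .
      qed
      have dom_u: "dom u = (\<Union>\<eta>\<in>C. dom \<eta>)"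
      proof
        show "dom u \<subseteq> (\<Union>\<eta>\<in>C. dom \<eta>)" by (auto simp: u_def split: if_splits)
        show "(\<Union>\<eta>\<in>C. dom \<eta>) \<subseteq> dom u" using u by fastforce
      qed
      have le: "\<eta> \<subseteq>\<^sub>m u" if "\<eta> \<in> C" for \<eta>
        using u[OF that] by (auto simp: map_le_def)
      obtain \<eta>0 where \<eta>0: "\<eta>0 \<in> C" using False by blast
      have usg: "unit_speed_geodesic x \<eta>" if "\<eta> \<in> C" for \<eta>
        using CA[OF that] by (simp add: A_def)
      have "unit_speed_geodesic x u"
        unfolding unit_speed_geodesic_def
      proof (intro conjI ballI)
        have int: "is_interval (dom \<eta>)" "dom \<eta> \<subseteq> {0..}" "0 \<in> dom \<eta>" if "\<eta> \<in> C" for \<eta>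
          using usg[OF that] by (auto simp: unit_speed_geodesic_def)
        show "is_interval (dom u)"
          unfolding is_interval_1
        proof (intro ballI allI impI)
          fix a b t assume ab: "a \<in> dom u" "b \<in> dom u" "a \<le> t \<and> t \<le> b"
          then obtain \<eta> \<eta>' where "\<eta> \<in> C" "b \<in> dom \<eta>" "\<eta>' \<in> C" "a \<in> dom \<eta>'"
            unfolding dom_u by (elim UN_E)
          \<comment> \<open>All domains contain 0, so a parameter between \<open>a\<close> and
            \<open>b\<close> already lies in the domain of the member that contains
            \<open>b\<close>.\<close>
          moreover have "0 \<le> a" using subsetD[OF int(2)[OF \<open>\<eta>' \<in> C\<close>] \<open>a \<in> dom \<eta>'\<close>] by simp
          ultimately have "t \<in> dom \<eta>"
            using mem_is_interval_1_I[OF int(1)[OF \<open>\<eta> \<in> C\<close>] int(3)[OF \<open>\<eta> \<in> C\<close>] \<open>b \<in> dom \<eta>\<close>, of t] ab(3)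
            by linarith
          then show "t \<in> dom u" using \<open>\<eta> \<in> C\<close> dom_u by blast
        qed
        show "dom u \<subseteq> {0..}" unfolding dom_u by (rule UN_least) (rule int(2))
        show "dom u \<noteq> {0}"
        proof
          assume "dom u = {0}"
          then have "dom \<eta>0 \<subseteq> {0}" using \<eta>0 dom_u by blast
          then show False using int(3)[OF \<eta>0] usg[OF \<eta>0] by (auto simp: unit_speed_geodesic_def)
        qed
        show "u 0 = Some x"
          using u[OF \<eta>0 int(3)[OF \<eta>0]] usg[OF \<eta>0] by (simp add: unit_speed_geodesic_def)
        fix s t assume "s \<in> dom u" "t \<in> dom u"
        then obtain \<eta> \<eta>' where "\<eta> \<in> C" "s \<in> dom \<eta>" "\<eta>' \<in> C" "t \<in> dom \<eta>'"
          unfolding dom_u by (elim UN_E)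
        then obtain \<xi> where \<xi>: "\<xi> \<in> C" "s \<in> dom \<xi>" "t \<in> dom \<xi>"
          using chain[of \<eta> \<eta>'] map_le_implies_dom_le by blast
        then show "dist (the (u s)) (the (u t)) = \<bar>s - t\<bar>"
          using usg[OF \<xi>(1)] u[OF \<xi>(1)] by (simp add: unit_speed_geodesic_def)
      qed
      moreover have "\<gamma> \<subseteq>\<^sub>m u"
        using CA[OF \<eta>0] le[OF \<eta>0] map_le_trans by (auto simp: A_def)
      ultimately show ?thesis using le by (auto simp: A_def)
    qed
  qed
  then show ?thesis
    unfolding A_def maximal_rays_def by (auto intro: map_le_trans)
qed

text \<open>Evaluation at scale \<open>r\<close> is meaningful only if the ray reaches the parameter
  r s. The domain assigned to the apex makes it feasible at every nonnegative scale.\<close>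

definition feasible :: "'a cone_point \<Rightarrow> real \<Rightarrow> bool" where
  "feasible p r \<longleftrightarrow> 0 \<le> r \<and> r * cone_radius p \<in> cone_dom p"

lemma cone_carrierE:
  assumes "p \<in> cone_carrier x"
  obtains "p = Apex" | \<gamma> s where "p = Ray \<gamma> s" "\<gamma> \<in> maximal_rays x" "0 < s"
  using assms by (auto simp: cone_carrier_def)

lemma Apex_in_carrier [simp]: "Apex \<in> cone_carrier x"
  by (simp add: cone_carrier_def)

lemma cone_radius_nonneg: "p \<in> cone_carrier x \<Longrightarrow> 0 \<le> cone_radius p"
  by (elim cone_carrierE) auto

lemma maximal_rayD:
  assumes "\<gamma> \<in> maximal_rays x"
  shows "\<gamma> 0 = Some x" "0 \<in> dom \<gamma>" "\<And>t. t \<in> dom \<gamma> \<Longrightarrow> 0 \<le> t"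
    "\<And>s t. t \<in> dom \<gamma> \<Longrightarrow> 0 \<le> s \<Longrightarrow> s \<le> t \<Longrightarrow> s \<in> dom \<gamma>"
    "\<And>s t. s \<in> dom \<gamma> \<Longrightarrow> t \<in> dom \<gamma> \<Longrightarrow> dist (the (\<gamma> s)) (the (\<gamma> t)) = \<bar>s - t\<bar>"
    "\<exists>a\<in>dom \<gamma>. 0 < a"
proof -
  have u: "unit_speed_geodesic x \<gamma>" using assms by (simp add: maximal_rays_def)
  then show *: "\<gamma> 0 = Some x" "0 \<in> dom \<gamma>" "\<And>t. t \<in> dom \<gamma> \<Longrightarrow> 0 \<le> t"
    "\<And>s t. s \<in> dom \<gamma> \<Longrightarrow> t \<in> dom \<gamma> \<Longrightarrow> dist (the (\<gamma> s)) (the (\<gamma> t)) = \<bar>s - t\<bar>"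
    by (auto simp: unit_speed_geodesic_def)
  show "s \<in> dom \<gamma>" if "t \<in> dom \<gamma>" "0 \<le> s" "s \<le> t" for s t
    using u that *(2) unfolding unit_speed_geodesic_def is_interval_1 by blast
  have "dom \<gamma> \<noteq> {0}" using u by (simp add: unit_speed_geodesic_def)
  then obtain a where "a \<in> dom \<gamma>" "a \<noteq> 0" using *(2) by auto
  then show "\<exists>a\<in>dom \<gamma>. 0 < a" using *(3)[of a] by (intro bexI[of _ a]) auto
qed

lemma cone_dom_0: "p \<in> cone_carrier x \<Longrightarrow> \<exists>a>0. {0..a} \<subseteq> cone_dom p"
proof (erule cone_carrierE)
  fix \<gamma> s assume "p = Ray \<gamma> s" "\<gamma> \<in> maximal_rays x"
  then show "\<exists>a>0. {0..a} \<subseteq> cone_dom p"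
    using maximal_rayD(4,6)[of \<gamma> x] by fastforce
qed (auto intro: exI[of _ 1])

lemma feasible_mono:
  assumes "p \<in> cone_carrier x" "feasible p r" "0 \<le> r'" "r' \<le> r"
  shows "feasible p r'"
  using assms(1)
proof (cases rule: cone_carrierE)
  case (2 \<gamma> s)
  then show ?thesis
    using assms maximal_rayD(4)[OF 2(2), of "r * s" "r' * s"]
    by (auto simp: feasible_def mult_right_mono)
qed (use assms in \<open>auto simp: feasible_def\<close>)

lemma dist_cone_eval:
  assumes "p \<in> cone_carrier x" "feasible p r" "feasible p s"
  shows "dist (cone_eval x p r) (cone_eval x p s) = \<bar>r - s\<bar> * cone_radius p"
  using assms(1)
proof (cases rule: cone_carrierE)
  case (2 \<gamma> t)
  then have "dist (cone_eval x p r) (cone_eval x p s) = \<bar>r * t - s * t\<bar>"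
    using assms maximal_rayD(5)[OF 2(2), of "r * t" "s * t"] by (simp add: feasible_def)
  also have "\<dots> = \<bar>r - s\<bar> * t" using 2(3) by (simp add: abs_mult flip: left_diff_distrib)
  finally show ?thesis using 2 by simp
qed simp

lemma cone_eval_0: "p \<in> cone_carrier x \<Longrightarrow> cone_eval x p 0 = x"
  by (elim cone_carrierE) (auto simp: maximal_rayD)

lemma feasible_0: "p \<in> cone_carrier x \<Longrightarrow> feasible p 0"
  by (elim cone_carrierE) (auto simp: maximal_rayD feasible_def)

lemma dist_cone_eval_base:
  assumes "p \<in> cone_carrier x" "feasible p r"
  shows "dist x (cone_eval x p r) = r * cone_radius p"
  using dist_cone_eval[OF assms(1) feasible_0[OF assms(1)] assms(2)] assms
  by (simp add: cone_eval_0 feasible_def)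

text \<open>Busemann concavity speaks of geodesics on [0,1], so the initial piece of a ray is
  reparametrised to that interval.\<close>

lemma geodesic_cone_eval:
  assumes "p \<in> cone_carrier x" "feasible p r"
  shows "geodesic (\<lambda>u. cone_eval x p (u * r)) x (cone_eval x p r)"
  unfolding geodesic_def
proof (intro conjI ballI)
  have r: "0 \<le> r" using assms by (simp add: feasible_def)
  fix t s :: real assume ts: "t \<in> {0..1}" "s \<in> {0..1}"
  have f: "feasible p (u * r)" if "u \<in> {0..1}" for u
    using assms r that by (intro feasible_mono[OF assms]) (auto intro: mult_left_le_one_le)
  have "dist (cone_eval x p (t * r)) (cone_eval x p (s * r)) = \<bar>t * r - s * r\<bar> * cone_radius p"
    using dist_cone_eval[OF assms(1)] f ts by simp
  also have "\<bar>t * r - s * r\<bar> = \<bar>t - s\<bar> * r" using r by (simp add: abs_mult flip: left_diff_distrib)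
  finally show "dist (cone_eval x p (t * r)) (cone_eval x p (s * r)) = \<bar>t - s\<bar> * dist x (cone_eval x p r)"
    using assms by (simp add: dist_cone_eval_base)
qed (use assms in \<open>simp_all add: cone_eval_0\<close>)

lemma feasible_eventually:
  assumes "p \<in> cone_carrier x"
  shows "\<forall>\<^sub>F r in at_right 0. feasible p r"
proof -
  obtain a where a: "0 < a" "{0..a} \<subseteq> cone_dom p" using cone_dom_0[OF assms] by blast
  have s: "0 \<le> cone_radius p" using cone_radius_nonneg assms .
  \<comment> \<open>Adding 1 to the radius avoids division by 0 at the apex.\<close>
  have "feasible p r" if "0 < r" "r < a / (cone_radius p + 1)" for r
  proof -
    have "r * cone_radius p \<le> r * (cone_radius p + 1)" using that by simp
    also have "\<dots> \<le> a" using that s by (simp add: pos_less_divide_eq less_imp_le)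
    finally show ?thesis using a that s by (auto simp: feasible_def)
  qed
  then show ?thesis
    using a s by (auto simp: eventually_at_right intro!: exI[of _ "a / (cone_radius p + 1)"])
qed

lemma dist_cone_eval_le:
  assumes "p \<in> cone_carrier x" "q \<in> cone_carrier x" "feasible p r" "feasible q r"
  shows "dist (cone_eval x p r) (cone_eval x q r) \<le> r * (cone_radius p + cone_radius q)"
  using dist_triangle3[of "cone_eval x p r" "cone_eval x q r" x] assms
  by (simp add: dist_cone_eval_base algebra_simps)

text \<open>A right inverse of evaluation at scale \<open>l\<close>, like the logarithm of an
  exponential map: follow a geodesic to \<open>y\<close> at unit speed, extend it to a maximal ray,
  and take the radius that evaluation shrinks back to the length of the geodesic. That radius is the
  rescaled distance, so balls of equal radius correspond.\<close>

lemma cone_log: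
  fixes x y :: "'a::metric_space"
  assumes "geodesic_space TYPE('a)" "0 < l"
  shows "\<exists>p\<in>cone_carrier x. feasible p l \<and> cone_eval x p l = y \<and> cone_radius p = dist x y / l"
proof (cases "x = y")
  case True
  then show ?thesis using \<open>0 < l\<close> by (intro bexI[of _ Apex]) (auto simp: feasible_def)
next
  case False
  define L where "L = dist x y"
  have L: "0 < L" using False by (simp add: L_def)
  obtain \<gamma> where \<gamma>: "geodesic \<gamma> x y" using assms unfolding geodesic_space_def by blast
  define \<eta> where "\<eta> t = (if 0 \<le> t \<and> t \<le> L then Some (\<gamma> (t / L)) else None)" for t
  have dom: "dom \<eta> = {0..L}" by (auto simp: \<eta>_def split: if_splits)
  have "unit_speed_geodesic x \<eta>"
    unfolding unit_speed_geodesic_def dom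
  proof (intro conjI ballI)
    show "\<eta> 0 = Some x" using \<gamma> L by (simp add: \<eta>_def geodesic_def)
    show "{0..L} \<noteq> {0}" using L by (auto simp: set_eq_iff intro!: exI[of _ L])
    fix s t assume st: "s \<in> {0..L}" "t \<in> {0..L}"
    then have "dist (\<gamma> (s / L)) (\<gamma> (t / L)) = \<bar>s / L - t / L\<bar> * L"
      using \<gamma> L unfolding geodesic_def L_def by simp
    also have "\<dots> = \<bar>s - t\<bar>" using L by (simp flip: diff_divide_distrib)
    finally show "dist (the (\<eta> s)) (the (\<eta> t)) = \<bar>s - t\<bar>" using st by (simp add: \<eta>_def)
  qed (auto simp: is_interval_cc)
  then obtain \<zeta> where \<zeta>: "\<zeta> \<in> maximal_rays x" "\<eta> \<subseteq>\<^sub>m \<zeta>" using maximal_ray_extension by blast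
  have "\<zeta> L = \<eta> L" using \<zeta>(2) L dom by (auto simp: map_le_def)
  also have "\<eta> L = Some y" using \<gamma> L by (simp add: \<eta>_def geodesic_def)
  finally have "\<zeta> L = Some y" .
  then show ?thesis
    using \<zeta>(1) L \<open>0 < l\<close>
    by (intro bexI[of _ "Ray \<zeta> (L / l)"]) (auto simp: cone_carrier_def feasible_def L_def)
qed

section \<open>The metric on the uncompleted cone\<close>

context
  fixes x :: "'a::metric_space"
  assumes bus: "busemann_concave TYPE('a)"
begin

text \<open>The distance of the two geodesics is a concave function that vanishes at 0, so its value
  at r'/r is at least r'/r times its value at 1.\<close>

lemma slope_antimono:
  assumes p: "p \<in> cone_carrier x" "feasible p r" and q: "q \<in> cone_carrier x" "feasible q r"
    and r: "0 < r'" "r' \<le> r"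
  shows "dist (cone_eval x p r) (cone_eval x q r) / r \<le> dist (cone_eval x p r') (cone_eval x q r') / r'"
proof -
  define f where "f u = dist (cone_eval x p (u * r)) (cone_eval x q (u * r))" for u
  have "concave_on {0..1} f"
    using bus geodesic_cone_eval[OF p] geodesic_cone_eval[OF q]
    unfolding busemann_concave_def f_def by blast
  then have "(1 - r' / r) * f 0 + r' / r * f 1 \<le> f ((1 - r' / r) *\<^sub>R 0 + (r' / r) *\<^sub>R 1)"
    using r by (intro concave_onD) auto
  then have "r' / r * f 1 \<le> f (r' / r)"
    using p q by (simp add: f_def cone_eval_0)
  then have "r' / r * dist (cone_eval x p r) (cone_eval x q r) \<le> dist (cone_eval x p r') (cone_eval x q r')"
    using r by (simp add: f_def)
  then show ?thesis using r by (simp add: field_simps)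
qed

text \<open>Since the quotients grow as the scale decreases, the supremum is the limit at 0. This
  frees later arguments from the chosen length \<open>a\<close> and from the restriction to scales
  at most 1.\<close>

lemma
  assumes p: "p \<in> cone_carrier x" and q: "q \<in> cone_carrier x"
  shows cone_dist_ge: "\<And>r. 0 < r \<Longrightarrow> feasible p r \<Longrightarrow> feasible q r \<Longrightarrow>
      dist (cone_eval x p r) (cone_eval x q r) / r \<le> cone_dist x p q"
    and cone_dist_tendsto:
      "((\<lambda>r. dist (cone_eval x p r) (cone_eval x q r) / r) \<longlongrightarrow> cone_dist x p q) (at_right 0)"
proof -
  define f where "f r = dist (cone_eval x p r) (cone_eval x q r) / r" for r
  define a where "a = (SOME a. 0 < a \<and> {0..a} \<subseteq> cone_dom p \<inter> cone_dom q)"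
  have "\<exists>a. 0 < a \<and> {0..a} \<subseteq> cone_dom p \<inter> cone_dom q"
  proof -
    obtain a b where "0 < a" "{0..a} \<subseteq> cone_dom p" "0 < b" "{0..b} \<subseteq> cone_dom q"
      using cone_dom_0[OF p] cone_dom_0[OF q] by blast
    then show ?thesis by (intro exI[of _ "min a b"]) auto
  qed
  then have a: "0 < a" "{0..a} \<subseteq> cone_dom p \<inter> cone_dom q"
    using someI_ex[of "\<lambda>a. 0 < a \<and> {0..a} \<subseteq> cone_dom p \<inter> cone_dom q"] unfolding a_def by blast+
  define I where "I = {r. 0 < r \<and> r \<le> 1 \<and> max (r * cone_radius p) (r * cone_radius q) \<le> a}"
  have d: "cone_dist x p q = (SUP r\<in>I. f r)"
    using p q unfolding cone_dist_def Let_def I_def f_def a_def by (simp only: conj_absorb if_True simp_thms)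
  have rad: "0 \<le> cone_radius p" "0 \<le> cone_radius q" using p q by (auto intro: cone_radius_nonneg)
  have fI: "feasible p r" "feasible q r" "0 < r" if "r \<in> I" for r
    using that a rad by (auto simp: I_def feasible_def)
  have bdd: "bdd_above (f ` I)"
    using dist_cone_eval_le[OF p q] fI
    by (intro bdd_aboveI2[of _ _ "cone_radius p + cone_radius q"]) (auto simp: f_def field_simps)
  have I_ev: "\<exists>b>0. \<forall>r. 0 < r \<and> r \<le> b \<longrightarrow> r \<in> I"
  proof (intro exI conjI allI impI)
    let ?c = "cone_radius p + cone_radius q + 1"
    show "0 < min 1 (a / ?c)" using a rad by simp
    fix r assume r: "0 < r \<and> r \<le> min 1 (a / ?c)"
    then have "r * ?c \<le> a" using rad by (simp add: pos_le_divide_eq)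
    moreover have "r * cone_radius p \<le> r * ?c" "r * cone_radius q \<le> r * ?c"
      using r rad by (auto intro: mult_left_mono)
    ultimately have "r * cone_radius p \<le> a" "r * cone_radius q \<le> a" by linarith+
    then show "r \<in> I" using r by (simp add: I_def)
  qed
  then obtain b where b: "0 < b" "\<And>r. 0 < r \<Longrightarrow> r \<le> b \<Longrightarrow> r \<in> I" by blast
  show ge: "dist (cone_eval x p r) (cone_eval x q r) / r \<le> cone_dist x p q"
    if "0 < r" "feasible p r" "feasible q r" for r
  proof -
    \<comment> \<open>A feasible scale may exceed 1 or violate the bound by \<open>a\<close>;
      shrinking it into \<open>I\<close> can only increase the quotient.\<close>
    have "f r \<le> f (min r b)"
      unfolding f_def using that b by (intro slope_antimono p q) auto
    also have "\<dots> \<le> (SUP r\<in>I. f r)"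
      using that b(1) by (intro cSUP_upper[OF b(2) bdd]) auto
    finally show ?thesis by (simp add: d f_def)
  qed
  show "((\<lambda>r. dist (cone_eval x p r) (cone_eval x q r) / r) \<longlongrightarrow> cone_dist x p q) (at_right 0)"
    unfolding f_def[symmetric]
  proof (rule order_tendstoI)
    fix c assume "c < cone_dist x p q"
    moreover have "I \<noteq> {}" using b(2)[OF b(1)] by auto
    ultimately obtain r where r: "r \<in> I" "c < f r" unfolding d less_cSUP_iff[OF \<open>I \<noteq> {}\<close> bdd] by auto
    have "c < f r'" if "0 < r'" "r' < r" for r'
    proof -
      have "f r \<le> f r'" unfolding f_def using that fI r by (intro slope_antimono p q) auto
      then show ?thesis using r by simp
    qed
    then show "\<forall>\<^sub>F r in at_right 0. c < f r"
      using fI(3)[OF r(1)] by (auto simp: eventually_at_right intro!: exI[of _ r])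
  next
    fix c assume "cone_dist x p q < c"
    moreover have "f r \<le> cone_dist x p q" if "0 < r" "r < b" for r
      using ge[OF that(1) fI(1,2)[OF b(2)[OF that(1) less_imp_le[OF that(2)]]]] by (simp add: f_def)
    ultimately show "\<forall>\<^sub>F r in at_right 0. f r < c"
      using b(1) by (auto simp: eventually_at_right intro!: exI[of _ b] intro: order_le_less_trans)
  qed
qed

lemma cone_dist_eqI:
  assumes "p \<in> cone_carrier x" "q \<in> cone_carrier x"
    and "((\<lambda>r. dist (cone_eval x p r) (cone_eval x q r) / r) \<longlongrightarrow> L) (at_right 0)"
  shows "cone_dist x p q = L"
  using cone_dist_tendsto[OF assms(1,2)] assms(3) by (rule tendsto_unique[rotated]) simp

lemma cone_dist_Apex:
  assumes "p \<in> cone_carrier x"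
  shows "cone_dist x Apex p = cone_radius p"
proof (rule cone_dist_eqI)
  have "\<forall>\<^sub>F r in at_right 0. cone_radius p = dist (cone_eval x Apex r) (cone_eval x p r) / r"
    using feasible_eventually[OF assms] eventually_at_right_less[of 0]
  proof eventually_elim
    case (elim r)
    then show ?case using dist_cone_eval_base[OF assms, of r] by simp
  qed
  then show "((\<lambda>r. dist (cone_eval x Apex r) (cone_eval x p r) / r) \<longlongrightarrow> cone_radius p) (at_right 0)"
    by (rule tendsto_eventually[OF eventually_mono]) simp
qed (use assms in auto)

lemma cone_eval_eq_if_cone_dist_0:
  assumes "p \<in> cone_carrier x" "q \<in> cone_carrier x" "cone_dist x p q = 0"
    and "0 < r" "feasible p r" "feasible q r"
  shows "cone_eval x p r = cone_eval x q r"
  using cone_dist_ge[OF assms(1,2,4-6)] assms(3,4) by (simp add: divide_le_0_iff)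

text \<open>Distance 0 forces the evaluations to agree at every common feasible scale. Hence the
  radii agree, and so do the rays where both are defined. Their domains are intervals starting at 0,
  so one contains the other, and maximality makes the rays equal.\<close>

lemma cone_dist_0_imp_eq:
  assumes p: "p \<in> cone_carrier x" and q: "q \<in> cone_carrier x" and 0: "cone_dist x p q = 0"
  shows "p = q"
proof -
  note eq = cone_eval_eq_if_cone_dist_0[OF p q 0]
  have "\<forall>\<^sub>F r in at_right 0. 0 < r \<and> feasible p r \<and> feasible q r"
    using feasible_eventually[OF p] feasible_eventually[OF q] eventually_at_right_less[of 0]
    by eventually_elim simp
  then obtain r where r: "0 < r" "feasible p r" "feasible q r"
    using eventually_happens'[OF trivial_limit_at_right_real] by blast
  then have rad: "cone_radius p = cone_radius q"
    using dist_cone_eval_base[OF p, of r] dist_cone_eval_base[OF q, of r] eq[of r] by simp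
  show ?thesis
    using p
  proof (cases rule: cone_carrierE)
    case 1
    then show ?thesis using q rad by (elim cone_carrierE) auto
  next
    case (2 \<gamma> s)
    then obtain \<eta> where \<eta>: "q = Ray \<eta> s" "\<eta> \<in> maximal_rays x"
      using q rad by (elim cone_carrierE) auto
    have agree: "\<gamma> t = \<eta> t" if t: "t \<in> dom \<gamma>" "t \<in> dom \<eta>" for t
    proof (cases "t = 0")
      case True
      then show ?thesis using maximal_rayD(1)[OF 2(2)] maximal_rayD(1)[OF \<eta>(2)] by simp
    next
      case False
      then have "0 < t" using maximal_rayD(3)[OF 2(2) t(1)] by simp
      then have "cone_eval x p (t / s) = cone_eval x q (t / s)"
        using 2 \<eta> t by (intro eq) (auto simp: feasible_def)
      then show ?thesis using 2 \<eta> t by auto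
    qed
    have "dom \<gamma> \<subseteq> dom \<eta> \<or> dom \<eta> \<subseteq> dom \<gamma>"
    proof (rule ccontr)
      assume "\<not> ?thesis"
      then obtain s t where st: "s \<in> dom \<gamma>" "s \<notin> dom \<eta>" "t \<in> dom \<eta>" "t \<notin> dom \<gamma>" by blast
      then have "0 \<le> s" "0 \<le> t" using maximal_rayD(3)[OF 2(2)] maximal_rayD(3)[OF \<eta>(2)] by auto
      then show False
        using st maximal_rayD(4)[OF 2(2) st(1), of t] maximal_rayD(4)[OF \<eta>(2) st(3), of s] by linarith
    qed
    then have "\<gamma> \<subseteq>\<^sub>m \<eta> \<or> \<eta> \<subseteq>\<^sub>m \<gamma>"
      using agree by (force simp: map_le_def)
    then have "\<gamma> = \<eta>"
      using 2(2) \<eta>(2) unfolding maximal_rays_def by blast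
    then show ?thesis using 2 \<eta> by simp
  qed
qed

text \<open>Nonnegativity, symmetry and the triangle inequality are inherited from X by passing to
  the limit of the rescaled distances.\<close>

lemma Metric_space_cone: "Metric_space (cone_carrier x) (cone_dist x)"
proof
  show "0 \<le> cone_dist x p q" for p q
  proof (cases "p \<in> cone_carrier x \<and> q \<in> cone_carrier x")
    case True
    then show ?thesis
      by (intro tendsto_lowerbound[OF cone_dist_tendsto])
        (auto intro!: eventually_mono[OF eventually_at_right_less[of 0]])
  qed (auto simp: cone_dist_def)
  show "cone_dist x p q = cone_dist x q p" for p q
  proof (cases "p \<in> cone_carrier x \<and> q \<in> cone_carrier x")
    case True
    then show ?thesis
      using cone_dist_tendsto[of q p] by (intro cone_dist_eqI) (auto simp: dist_commute)
  qed (auto simp: cone_dist_def)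
next
  fix p q assume "p \<in> cone_carrier x" "q \<in> cone_carrier x"
  then show "cone_dist x p q = 0 \<longleftrightarrow> p = q"
    using cone_dist_0_imp_eq cone_dist_eqI[of p p 0] by auto
next
  fix p q s assume *: "p \<in> cone_carrier x" "q \<in> cone_carrier x" "s \<in> cone_carrier x"
  show "cone_dist x p s \<le> cone_dist x p q + cone_dist x q s"
  proof (rule tendsto_le[OF _ tendsto_add[OF cone_dist_tendsto cone_dist_tendsto] cone_dist_tendsto])
    show "\<forall>\<^sub>F r in at_right 0. dist (cone_eval x p r) (cone_eval x s r) / r
        \<le> dist (cone_eval x p r) (cone_eval x q r) / r + dist (cone_eval x q r) (cone_eval x s r) / r"
      using eventually_at_right_less[of 0]
    proof eventually_elim
      case (elim r)
      then show ?case
        by (simp add: divide_right_mono dist_triangle flip: add_divide_distrib)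
    qed
  qed (use * in auto)
qed

end

section \<open>Dilations of the cone\<close>

fun cone_scale :: "real \<Rightarrow> 'a cone_point \<Rightarrow> 'a cone_point" where
  "cone_scale c Apex = Apex"
| "cone_scale c (Ray \<gamma> s) = Ray \<gamma> (c * s)"

lemma cone_scale_in: "0 < c \<Longrightarrow> p \<in> cone_carrier x \<Longrightarrow> cone_scale c p \<in> cone_carrier x"
  by (elim cone_carrierE) (auto simp: cone_carrier_def)

lemma cone_radius_scale: "cone_radius (cone_scale c p) = c * cone_radius p"
  by (cases p) auto

lemma cone_eval_scale: "cone_eval x (cone_scale c p) r = cone_eval x p (c * r)"
  by (cases p) (auto simp: mult_ac)

lemma cone_scale_scale: "cone_scale b (cone_scale c p) = cone_scale (b * c) p"
  by (cases p) auto

lemma cone_scale_1: "cone_scale 1 p = p"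
  by (cases p) auto

text \<open>Substitute c r for \<open>r\<close> in the limit that computes the distance.\<close>

lemma cone_dist_scale:
  fixes x :: "'a::metric_space"
  assumes bus: "busemann_concave TYPE('a)" and "0 < c" and p: "p \<in> cone_carrier x" and q: "q \<in> cone_carrier x"
  shows "cone_dist x (cone_scale c p) (cone_scale c q) = c * cone_dist x p q"
proof (rule cone_dist_eqI[OF bus])
  have "filterlim (\<lambda>r. c * r) (at_right 0) (at_right (0::real))"
    using filtermap_times_pos_at_right[OF \<open>0 < c\<close>, of 0] by (simp add: filterlim_def)
  then have "((\<lambda>r. c * (dist (cone_eval x p (c * r)) (cone_eval x q (c * r)) / (c * r))) \<longlongrightarrow> c * cone_dist x p q) (at_right 0)"
    by (intro tendsto_mult tendsto_const filterlim_compose[OF cone_dist_tendsto[OF bus p q]])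
  then show "((\<lambda>r. dist (cone_eval x (cone_scale c p) r) (cone_eval x (cone_scale c q) r) / r) \<longlongrightarrow> c * cone_dist x p q) (at_right 0)"
    using \<open>0 < c\<close> by (simp add: cone_eval_scale)
qed (use assms in \<open>auto intro: cone_scale_in\<close>)

section \<open>Rescaled balls\<close>

text \<open>In a Busemann concave space this is the open ball about the apex, by
  \<open>cone_dist_Apex\<close>. It is taken in the uncompleted cone, where points can be evaluated
  and dilated.\<close>

definition cone_ball :: "'a::metric_space \<Rightarrow> real \<Rightarrow> 'a cone_point set" where
  "cone_ball x R = {p \<in> cone_carrier x. cone_radius p < R}"

lemma Metric_space_scaled: "0 < l \<Longrightarrow> Metric_space UNIV (scaled_dist l)"
  by unfold_locales
    (auto simp: scaled_dist_def dist_commute dist_triangle divide_right_mono simp flip: add_divide_distrib)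

lemma mball_scaled:
  "0 < l \<Longrightarrow> Metric_space.mball UNIV (scaled_dist l) x r = {y. dist x y < r * l}"
  by (auto simp: Metric_space.mball_def[OF Metric_space_scaled] scaled_dist_def pos_divide_less_eq)

context
  fixes x :: "'a::metric_space"
  assumes bus: "busemann_concave TYPE('a)"
begin

interpretation H: Metric_space "cone_carrier x" "cone_dist x"
  by (rule Metric_space_cone[OF bus])

interpretation T: Metric_space "tangent_cone x" "tangent_dist x"
  unfolding tangent_cone_def tangent_dist_def by (rule H.Metric_space_completion)

lemma mcomplete_tangent_cone: "T.mcomplete"
  using H.mcomplete_completion unfolding tangent_cone_def tangent_dist_def .

lemma tangent_apex_in: "tangent_apex x \<in> tangent_cone x"
  unfolding tangent_cone_def tangent_apex_def by (rule H.completion_embed_in) simp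

lemma cone_ball_correspondence:
  assumes "0 < R" "0 < \<epsilon>"
  shows "\<exists>S. correspondence \<epsilon> (cone_ball x R) (cone_dist x)
      (T.mball (tangent_apex x) R) (tangent_dist x) S \<and> (Apex, tangent_apex x) \<in> S"
proof -
  let ?B = "cone_ball x R" and ?E = "completion_embed (cone_carrier x) (cone_dist x)"
    and ?TB = "T.mball (tangent_apex x) R"
  interpret B: Metric_space ?B "cone_dist x" by (rule H.subspace) (auto simp: cone_ball_def)
  have E: "?E p \<in> tangent_cone x" "tangent_dist x (tangent_apex x) (?E p) = cone_radius p"
    if "p \<in> cone_carrier x" for p
    using that H.completion_embed_in[OF that] H.completion_dist_embed[of Apex p] cone_dist_Apex[OF bus that]
    by (auto simp: tangent_cone_def tangent_dist_def tangent_apex_def)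
  have ball: "?E p \<in> ?TB" if "p \<in> ?B" for p
    using that E tangent_apex_in by (simp add: cone_ball_def)
  let ?S = "{(p, z). p \<in> ?B \<and> z \<in> ?TB \<and> tangent_dist x z (?E p) \<le> \<epsilon> / 2}"
  have "correspondence \<epsilon> ?B (cone_dist x) ?TB (tangent_dist x) ?S"
  proof (rule B.correspondence_dense_isometry)
    show "Metric_space ?TB (tangent_dist x)" by (rule T.subspace) auto
    show "?E ` ?B \<subseteq> ?TB" using ball by auto
    show "tangent_dist x (?E u) (?E v) = cone_dist x u v" if "u \<in> ?B" "v \<in> ?B" for u v
      using that H.completion_dist_embed by (simp add: tangent_dist_def cone_ball_def)
    show "\<exists>u\<in>?B. tangent_dist x z (?E u) < \<delta>" if z: "z \<in> ?TB" and "0 < \<delta>" for z \<delta>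
    proof -
      \<comment> \<open>The second bound keeps the approximating cone point inside the open ball:
        density is needed within the ball and not merely in the whole cone.\<close>
      let ?\<eta> = "min \<delta> (R - tangent_dist x (tangent_apex x) z)"
      have "0 < ?\<eta>" "z \<in> tangent_cone x" using z \<open>0 < \<delta>\<close> by simp_all
      then obtain p where p: "p \<in> cone_carrier x" "tangent_dist x z (?E p) < ?\<eta>"
        using H.completion_embed_dense[of z ?\<eta>] unfolding tangent_cone_def tangent_dist_def by blast
      have "tangent_dist x (tangent_apex x) (?E p) < R"
        using T.triangle[of "tangent_apex x" z "?E p"] E[OF p(1)] z p(2) tangent_apex_in by simp
      then show ?thesis using p E[OF p(1)] by (auto simp: cone_ball_def)
    qed
  qed fact
  moreover have "(Apex, tangent_apex x) \<in> ?S"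
    using assms tangent_apex_in by (auto simp: cone_ball_def) (simp add: tangent_apex_def[symmetric] tangent_apex_in)
  ultimately show ?thesis by blast
qed

text \<open>Local compactness concerns the completion, while dilations are defined on the
  uncompleted cone. So the small ball is first moved to the cone by a correspondence and enlarged
  there.\<close>

lemma mtotally_bounded_cone_ball:
  assumes lc: "locally_compact_space T.mtopology" and "0 < R"
  shows "Metric_space.mtotally_bounded (cone_ball x R) (cone_dist x) (cone_ball x R)"
proof -
  have ms: "Metric_space (cone_ball x r) (cone_dist x)" for r
    by (rule H.subspace) (auto simp: cone_ball_def)
  obtain U K where "openin T.mtopology U" "compactin T.mtopology K" "tangent_apex x \<in> U" "U \<subseteq> K"
    using lc tangent_apex_in unfolding locally_compact_space_def by auto
  then obtain \<delta> where \<delta>: "0 < \<delta>" "T.mball (tangent_apex x) \<delta> \<subseteq> K"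
    unfolding T.openin_mtopology by blast
  let ?TB = "T.mball (tangent_apex x) \<delta>"
  have "T.mtotally_bounded ?TB"
    using T.compactin_imp_mtotally_bounded[OF \<open>compactin T.mtopology K\<close>] \<delta>(2) T.mtotally_bounded_subset by blast
  then have tb: "Metric_space.mtotally_bounded ?TB (tangent_dist x) ?TB"
    using T.mtotally_bounded_absolute by blast
  have small: "Metric_space.mtotally_bounded (cone_ball x \<delta>) (cone_dist x) (cone_ball x \<delta>)"
  proof (rule mtotally_bounded_correspondence[OF _ ms tb])
    show "Metric_space ?TB (tangent_dist x)" by (rule T.subspace) auto
    show "\<exists>S. correspondence \<epsilon> ?TB (tangent_dist x) (cone_ball x \<delta>) (cone_dist x) S" if "0 < \<epsilon>" for \<epsilon>
      using cone_ball_correspondence[OF \<delta>(1) that] correspondence_converse by blast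
  qed
  \<comment> \<open>The dilation by \<open>c\<close> maps the ball of radius \<delta> onto that of
    radius \<open>R\<close> and multiplies errors by \<open>c\<close>, so a net of precision
    \<epsilon>/c is used.\<close>
  define c where "c = R / \<delta>"
  have c: "0 < c" using \<delta> \<open>0 < R\<close> by (simp add: c_def)
  show ?thesis
    unfolding Metric_space.mtotally_bounded_space[OF ms]
  proof (intro allI impI)
    fix \<epsilon> :: real assume "0 < \<epsilon>"
    then have "0 < \<epsilon> / c" using c by simp
    then obtain N where N: "finite N" "N \<subseteq> cone_ball x \<delta>" "\<forall>u\<in>cone_ball x \<delta>. \<exists>v\<in>N. cone_dist x v u < \<epsilon> / c"
      using small[unfolded Metric_space.mtotally_bounded_space[OF ms], rule_format, OF \<open>0 < \<epsilon> / c\<close>]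
      by (elim exE conjE)
    show "\<exists>N. finite N \<and> N \<subseteq> cone_ball x R \<and> (\<forall>u\<in>cone_ball x R. \<exists>v\<in>N. cone_dist x v u < \<epsilon>)"
    proof (intro exI[of _ "cone_scale c ` N"] conjI ballI)
      have "c * \<delta> = R" using \<delta> by (simp add: c_def)
      show "cone_scale c ` N \<subseteq> cone_ball x R"
      proof clarify
        fix p assume "p \<in> N"
        then have "p \<in> cone_carrier x" "cone_radius p < \<delta>" using N by (auto simp: cone_ball_def)
        then have "c * cone_radius p < c * \<delta>" using c by simp
        then show "cone_scale c p \<in> cone_ball x R"
          using \<open>c * \<delta> = R\<close> cone_scale_in[OF c \<open>p \<in> cone_carrier x\<close>]
          by (simp add: cone_ball_def cone_radius_scale)
      qed
      fix u assume u: "u \<in> cone_ball x R"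
      define u' where "u' = cone_scale (1 / c) u"
      have uu': "u = cone_scale c u'" using c by (simp add: u'_def cone_scale_scale cone_scale_1)
      have u'c: "u' \<in> cone_carrier x" using u c unfolding u'_def by (intro cone_scale_in) (auto simp: cone_ball_def)
      have "u' \<in> cone_ball x \<delta>"
        using u u'c c \<delta> by (auto simp: cone_ball_def u'_def cone_radius_scale c_def divide_simps mult.commute)
      then obtain v where v: "v \<in> N" "cone_dist x v u' < \<epsilon> / c" using N by blast
      then have "v \<in> cone_carrier x" using N by (auto simp: cone_ball_def)
      then have "cone_dist x (cone_scale c v) u = c * cone_dist x v u'"
        using cone_dist_scale[OF bus c _ u'c] uu' by simp
      also have "\<dots> < \<epsilon>" using v c by (simp add: pos_less_divide_eq mult.commute)
      finally show "\<exists>v\<in>cone_scale c ` N. cone_dist x v u < \<epsilon>" using v by blast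
    qed (use N in auto)
  qed
qed

lemma rescaled_ball_correspondence:
  assumes geo: "geodesic_space TYPE('a)" and "0 < R" "0 < \<epsilon>"
    and tb: "Metric_space.mtotally_bounded (cone_ball x R) (cone_dist x) (cone_ball x R)"
  shows "\<forall>\<^sub>F l in at_right 0. \<exists>S. correspondence \<epsilon> (Metric_space.mball UNIV (scaled_dist l) x R) (scaled_dist l)
      (cone_ball x R) (cone_dist x) S \<and> (x, Apex) \<in> S"
proof -
  \<comment> \<open>Error budget: 2\<eta> for moving two points of X to the image of the net, \<eta>
    for the distortion on the net, and 2\<eta> for moving from the net to two cone points.\<close>
  define \<eta> where "\<eta> = \<epsilon> / 5"
  have \<eta>: "0 < \<eta>" using \<open>0 < \<epsilon>\<close> by (simp add: \<eta>_def)
  have ms: "Metric_space (cone_ball x R) (cone_dist x)"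
    by (rule H.subspace) (auto simp: cone_ball_def)
  obtain N0 where N0: "finite N0" "N0 \<subseteq> cone_ball x R" "\<And>u. u \<in> cone_ball x R \<Longrightarrow> \<exists>v\<in>N0. cone_dist x v u < \<eta>"
    using tb[unfolded Metric_space.mtotally_bounded_space[OF ms], rule_format, OF \<eta>] by blast
  \<comment> \<open>The apex is added to the net so that the pair of base points belongs to the
    correspondence.\<close>
  define N where "N = insert Apex N0"
  have Apex: "Apex \<in> cone_ball x R" using \<open>0 < R\<close> by (simp add: cone_ball_def)
  have N: "finite N" "\<And>p. p \<in> N \<Longrightarrow> p \<in> cone_ball x R" "\<And>u. u \<in> cone_ball x R \<Longrightarrow> \<exists>v\<in>N. cone_dist x v u < \<eta>" "Apex \<in> N"
    using N0 Apex unfolding N_def by blast+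
  have car: "p \<in> cone_carrier x" "cone_radius p < R" if "p \<in> cone_ball x R" for p
    using that by (auto simp: cone_ball_def)
  have "\<forall>\<^sub>F l in at_right 0. \<forall>p\<in>N. feasible p l"
    by (intro eventually_ball_finite[OF N(1)] ballI) (rule feasible_eventually[OF car(1)[OF N(2)]])
  moreover have "\<forall>\<^sub>F l in at_right 0. \<forall>p\<in>N. \<forall>q\<in>N. \<bar>scaled_dist l (cone_eval x p l) (cone_eval x q l) - cone_dist x p q\<bar> < \<eta>"
  proof (intro eventually_ball_finite[OF N(1)] ballI)
    fix p q assume "p \<in> N" "q \<in> N"
    then have "((\<lambda>l. dist (cone_eval x p l) (cone_eval x q l) / l) \<longlongrightarrow> cone_dist x p q) (at_right 0)"
      by (intro cone_dist_tendsto[OF bus] car(1) N(2))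
    from tendstoD[OF this \<eta>]
    show "\<forall>\<^sub>F l in at_right 0. \<bar>scaled_dist l (cone_eval x p l) (cone_eval x q l) - cone_dist x p q\<bar> < \<eta>"
      by (simp add: scaled_dist_def dist_real_def)
  qed
  ultimately show ?thesis
    using eventually_at_right_less[of 0]
  proof eventually_elim
    case (elim l)
    interpret X: Metric_space UNIV "scaled_dist l :: 'a \<Rightarrow> 'a \<Rightarrow> real"
      by (rule Metric_space_scaled) (use elim in simp)
    let ?XB = "X.mball x R"
    \<comment> \<open>Points are related through a common net point, because a general point of the
      cone ball need not be feasible at scale \<open>l\<close>.\<close>
    define S where "S = {(u, p). u \<in> ?XB \<and> p \<in> cone_ball x R \<and>
        (\<exists>q\<in>N. scaled_dist l u (cone_eval x q l) \<le> \<eta> \<and> cone_dist x q p \<le> \<eta>)}"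
    have radius: "scaled_dist l x (cone_eval x q l) = cone_radius q" if "q \<in> N" for q
      using elim that dist_cone_eval_base[of q x l] car(1)[OF N(2)[OF that]] by (simp add: scaled_dist_def)
    have "correspondence \<epsilon> ?XB (scaled_dist l) (cone_ball x R) (cone_dist x) S"
    proof (rule correspondenceI)
      show "S \<subseteq> ?XB \<times> cone_ball x R" by (auto simp: S_def)
      show "\<exists>p. (u, p) \<in> S" if u: "u \<in> ?XB" for u
      proof -
        obtain p where p: "p \<in> cone_carrier x" "feasible p l" "cone_eval x p l = u" "cone_radius p = dist x u / l"
          using cone_log[OF geo] elim by blast
        then have pB: "p \<in> cone_ball x R" using u by (simp add: cone_ball_def scaled_dist_def)
        then obtain q where q: "q \<in> N" "cone_dist x q p < \<eta>" using N(3) by blast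
        \<comment> \<open>Evaluation does not increase distances, so closeness to a net point in the
          cone passes to X with no further smallness of \<open>l\<close>, although \<open>p\<close>
          depends on \<open>l\<close>.\<close>
        have "dist (cone_eval x p l) (cone_eval x q l) / l \<le> cone_dist x p q"
          using cone_dist_ge[OF bus p(1) car(1)[OF N(2)[OF q(1)]], of l] elim p q by simp
        then have "scaled_dist l u (cone_eval x q l) \<le> \<eta>"
          using p q by (simp add: scaled_dist_def H.commute)
        then have "(u, p) \<in> S" using u pB q by (auto simp: S_def intro!: bexI[of _ q])
        then show ?thesis ..
      qed
      show "\<exists>u. (u, p) \<in> S" if p: "p \<in> cone_ball x R" for p
      proof -
        obtain q where q: "q \<in> N" "cone_dist x q p < \<eta>" using N(3)[OF p] by blast
        have "cone_eval x q l \<in> ?XB" using radius[OF q(1)] car(2)[OF N(2)[OF q(1)]] by simp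
        then have "(cone_eval x q l, p) \<in> S" using p q \<eta> by (auto simp: S_def intro!: bexI[of _ q])
        then show ?thesis ..
      qed
      fix u p u' p' assume "(u, p) \<in> S" "(u', p') \<in> S"
      then obtain q q' where q: "q \<in> N" "scaled_dist l u (cone_eval x q l) \<le> \<eta>" "cone_dist x q p \<le> \<eta>"
        and q': "q' \<in> N" "scaled_dist l u' (cone_eval x q' l) \<le> \<eta>" "cone_dist x q' p' \<le> \<eta>"
        and p: "p \<in> cone_carrier x" "p' \<in> cone_carrier x"
        unfolding S_def using car(1) by blast
      let ?v = "cone_eval x q l" and ?v' = "cone_eval x q' l"
      have qc: "q \<in> cone_carrier x" "q' \<in> cone_carrier x" using car(1) N(2) q q' by auto
      have 1: "\<bar>scaled_dist l ?v ?v' - cone_dist x q q'\<bar> < \<eta>" using elim q q' by simp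
      have 2: "\<bar>scaled_dist l u u' - scaled_dist l ?v ?v'\<bar> \<le> 2 * \<eta>"
        using X.mdist_reverse_triangle[of u u' ?v] X.mdist_reverse_triangle[of u' ?v ?v'] q q'
        by (simp add: X.commute)
      have 3: "\<bar>cone_dist x q q' - cone_dist x p p'\<bar> \<le> 2 * \<eta>"
        using H.mdist_reverse_triangle[of q q' p] H.mdist_reverse_triangle[of q' p p'] q q' p qc
        by (simp add: H.commute)
      show "\<bar>scaled_dist l u u' - cone_dist x p p'\<bar> \<le> \<epsilon>"
        using 1 2 3 unfolding \<eta>_def by linarith
    qed
    moreover have "(x, Apex) \<in> S"
      using \<open>0 < R\<close> Apex N(4) \<eta> by (auto simp: S_def intro!: bexI[of _ Apex])
    ultimately show ?case by blast
  qed
qed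

lemma tangent_cone_ball_correspondence:
  assumes "geodesic_space TYPE('a)" "locally_compact_space T.mtopology" "0 < R" "0 < \<epsilon>"
  shows "\<forall>\<^sub>F l in at_right 0. \<exists>S. correspondence \<epsilon> (Metric_space.mball UNIV (scaled_dist l) x R) (scaled_dist l)
      (T.mball (tangent_apex x) R) (tangent_dist x) S \<and> (x, tangent_apex x) \<in> S"
proof -
  have "0 < \<epsilon>/2" using assms by simp
  obtain S' where S': "correspondence (\<epsilon>/2) (cone_ball x R) (cone_dist x)
      (T.mball (tangent_apex x) R) (tangent_dist x) S'" "(Apex, tangent_apex x) \<in> S'"
    using cone_ball_correspondence[OF \<open>0 < R\<close> \<open>0 < \<epsilon>/2\<close>] by blast
  show ?thesis
    using rescaled_ball_correspondence[OF assms(1,3) \<open>0 < \<epsilon>/2\<close> mtotally_bounded_cone_ball[OF assms(2,3)]]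
  proof eventually_elim
    case (elim l)
    then obtain S where S: "correspondence (\<epsilon>/2) (Metric_space.mball UNIV (scaled_dist l) x R) (scaled_dist l)
      (cone_ball x R) (cone_dist x) S" "(x, Apex) \<in> S" by blast
    have "(x, tangent_apex x) \<in> S O S'" using S(2) S'(2) by blast
    then show ?case using correspondence_comp[OF S(1) S'(1)] by auto
  qed
qed

lemma mtotally_bounded_tangent_ball:
  assumes "locally_compact_space T.mtopology" "0 < R"
  shows "T.mtotally_bounded (T.mball (tangent_apex x) R)"
proof -
  let ?TB = "T.mball (tangent_apex x) R"
  have "Metric_space.mtotally_bounded ?TB (tangent_dist x) ?TB"
  proof (rule mtotally_bounded_correspondence[OF _ _ mtotally_bounded_cone_ball[OF assms]])
    show "Metric_space (cone_ball x R) (cone_dist x)" by (rule H.subspace) (auto simp: cone_ball_def)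
    show "Metric_space ?TB (tangent_dist x)" by (rule T.subspace) auto
    show "\<exists>S. correspondence \<epsilon> (cone_ball x R) (cone_dist x) ?TB (tangent_dist x) S" if "0 < \<epsilon>" for \<epsilon>
      using cone_ball_correspondence[OF assms(2) that] by blast
  qed
  then show ?thesis
    using T.mtotally_bounded_absolute T.mball_subset_mspace by blast
qed

end

text \<open>\<open>M\<close> need not be compact, so the limit is its compact model. Nonemptiness of
  the spaces provides a related pair that can serve as base points, which makes the pointed gluing
  bound applicable.\<close>

lemma gh_limit_compact_model:
  fixes A :: "nat \<Rightarrow> 'a set" and M :: "'b set"
  assumes M: "Metric_space M dM" "Metric_space.mtotally_bounded M dM M"
    and A: "\<And>n. Metric_space (A n) (d n)" "\<And>n. A n \<noteq> {}"
    and lim: "\<And>\<epsilon>. 0 < \<epsilon> \<Longrightarrow> \<forall>\<^sub>F n in sequentially. \<exists>S. correspondence \<epsilon> (A n) (d n) M dM S"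
  shows "\<exists>(K :: real set) dK. Metric_space K dK \<and> compact_space (Metric_space.mtopology K dK) \<and>
     (\<lambda>n. gh_dist (A n) (d n) K dK) \<longlonglongrightarrow> 0"
proof -
  obtain K :: "real set" and dK where K: "Metric_space K dK" "compact_space (Metric_space.mtopology K dK)"
    "\<And>\<epsilon>. 0 < \<epsilon> \<Longrightarrow> \<exists>S. correspondence \<epsilon> M dM K dK S"
    using Metric_space.mtotally_bounded_compact_model[OF M] by blast
  have "(\<lambda>n. gh_dist (A n) (d n) K dK) \<longlonglongrightarrow> 0"
  proof (rule tendsto_ennreal_0I)
    fix e :: real assume "0 < e"
    \<comment> \<open>Two errors e/4 add up under composition, and the gluing bound doubles the
      sum.\<close>
    then have e4: "0 < e/4" by simp
    obtain S' where S': "correspondence (e/4) M dM K dK S'" using K(3)[OF e4] by blast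
    show "\<forall>\<^sub>F n in sequentially. gh_dist (A n) (d n) K dK \<le> ennreal e"
      using lim[OF e4]
    proof eventually_elim
      case (elim n)
      then obtain S where "correspondence (e/4) (A n) (d n) M dM S" by blast
      from correspondence_comp[OF this S']
      have S: "correspondence (e/2) (A n) (d n) K dK (S O S')" by simp
      obtain a where "a \<in> A n" using A(2) by blast
      then obtain b where ab: "(a, b) \<in> S O S'" using correspondenceD(3)[OF S] by blast
      have "gh_dist (A n) (d n) K dK \<le> pointed_gh_dist (A n) (d n) a K dK b"
        by (rule gh_dist_le_pointed)
      also have "\<dots> \<le> ennreal (2 * (e/2))"
        by (rule pointed_gh_dist_le[OF A(1) K(1) S ab]) (use \<open>0 < e\<close> in simp)
      finally show ?case by simp
    qed
  qed
  then show ?thesis using K by blast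
qed

text \<open>If the target ball is smaller, move \<open>y\<close> to the fraction l/m of a geodesic
  from \<open>x\<close>; this shifts it by (m - l)/m times \<open>dist x y\<close>. Otherwise
  \<open>y\<close> itself will do.\<close>

lemma geodesic_contraction:
  fixes x y :: "'a::metric_space"
  assumes "geodesic_space TYPE('a)" "0 < l" "0 < m" "dist x y < R * m"
  shows "\<exists>z. dist x z < R * l \<and> dist z y \<le> R * \<bar>l - m\<bar>"
proof -
  have "0 < R"
    using assms(3,4) by (meson le_less_trans zero_le_dist zero_less_mult_pos2)
  show ?thesis
  proof (cases "m \<le> l")
    case True
    then have "R * m \<le> R * l" using \<open>0 < R\<close> by simp
    then have "dist x y < R * l" using assms(4) by linarith
    then show ?thesis using \<open>0 < R\<close> by (intro exI[of _ y]) auto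
  next
    case False
    obtain \<gamma> where \<gamma>: "geodesic \<gamma> x y" using assms(1) unfolding geodesic_space_def by blast
    have lm: "l / m \<in> {0..1}" using False assms(2,3) by simp
    have x: "dist x (\<gamma> (l / m)) = l / m * dist x y"
      using \<gamma> lm unfolding geodesic_def by (metis abs_minus_commute abs_of_nonneg atLeastAtMost_iff diff_zero order_refl zero_le_one)
    have "\<bar>l / m - 1\<bar> = (m - l) / m" using False assms by (simp add: abs_if divide_simps)
    then have y: "dist (\<gamma> (l / m)) y = (m - l) / m * dist x y"
      using \<gamma> lm unfolding geodesic_def by (metis atLeastAtMost_iff order_refl zero_le_one)
    have "l / m * dist x y < l / m * (R * m)"
      using assms by (intro mult_strict_left_mono) auto
    then have 1: "dist x (\<gamma> (l / m)) < R * l" using x assms by (simp add: mult.commute)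
    have "(m - l) / m * dist x y \<le> (m - l) / m * (R * m)"
      using assms False by (intro mult_left_mono) auto
    then have 2: "dist (\<gamma> (l / m)) y \<le> R * \<bar>l - m\<bar>" using y assms False by (simp add: mult.commute)
    show ?thesis using 1 2 by blast
  qed
qed

text \<open>Half of the constant comes from displacing both points by at most R \<bar>l - m\<bar>,
  measured at scale \<open>l\<close>. The other half comes from changing the scale: a distance below
  2 R m is multiplied by \<bar>1/l - 1/m\<bar>.\<close>

lemma scaled_ball_correspondence:
  fixes x :: "'a::metric_space"
  assumes geo: "geodesic_space TYPE('a)" and "0 < l" "0 < m" "0 < R"
  shows "\<exists>S. correspondence (4 * R * \<bar>l - m\<bar> / l) {y. dist x y < R * l} (scaled_dist l)
     {y. dist x y < R * m} (scaled_dist m) S"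
proof
  let ?S = "{(u, v). dist x u < R * l \<and> dist x v < R * m \<and> dist u v \<le> R * \<bar>l - m\<bar>}"
  show "correspondence (4 * R * \<bar>l - m\<bar> / l) {y. dist x y < R * l} (scaled_dist l)
     {y. dist x y < R * m} (scaled_dist m) ?S"
  proof (rule correspondenceI)
    show "\<exists>v. (u, v) \<in> ?S" if "u \<in> {y. dist x y < R * l}" for u
      using geodesic_contraction[OF geo assms(3,2), of x u R] that by (auto simp: dist_commute abs_minus_commute)
    show "\<exists>u. (u, v) \<in> ?S" if "v \<in> {y. dist x y < R * m}" for v
      using geodesic_contraction[OF geo assms(2,3), of x v R] that by auto
    fix u v u' v' assume "(u, v) \<in> ?S" "(u', v') \<in> ?S"
    then have *: "dist x v < R * m" "dist x v' < R * m" "dist u v \<le> R * \<bar>l - m\<bar>" "dist u' v' \<le> R * \<bar>l - m\<bar>" by auto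
    have "\<bar>dist u u' - dist v v'\<bar> \<le> 2 * R * \<bar>l - m\<bar>"
      using *(3,4) dist_triangle[of u u' v] dist_triangle[of v u' v'] dist_triangle[of v v' u] dist_triangle[of u v' u']
      by (simp add: dist_commute abs_le_iff)
    then have 1: "\<bar>(dist u u' - dist v v') / l\<bar> \<le> 2 * R * \<bar>l - m\<bar> / l"
      using \<open>0 < l\<close> by (simp add: divide_right_mono)
    have "dist v v' \<le> 2 * R * m"
      using * dist_triangle3[of v v' x] by simp
    then have "dist v v' * (\<bar>m - l\<bar> / (l * m)) \<le> 2 * R * m * (\<bar>m - l\<bar> / (l * m))"
      using assms by (intro mult_right_mono) auto
    also have "\<dots> = 2 * R * \<bar>l - m\<bar> / l" using assms by (simp add: abs_minus_commute)
    also have "dist v v' * (\<bar>m - l\<bar> / (l * m)) = \<bar>dist v v' / l - dist v v' / m\<bar>"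
    proof -
      have "dist v v' / l - dist v v' / m = dist v v' * ((m - l) / (l * m))"
        using assms by (simp add: field_simps)
      then show ?thesis using assms by (simp add: abs_mult)
    qed
    finally have 2: "\<bar>dist v v' / l - dist v v' / m\<bar> \<le> 2 * R * \<bar>l - m\<bar> / l" .
    have "scaled_dist l u u' - scaled_dist m v v' = (dist u u' - dist v v') / l + (dist v v' / l - dist v v' / m)"
      by (simp add: scaled_dist_def diff_divide_distrib)
    then have "\<bar>scaled_dist l u u' - scaled_dist m v v'\<bar> \<le> 2 * R * \<bar>l - m\<bar> / l + 2 * R * \<bar>l - m\<bar> / l"
      using 1 2 by linarith
    then show "\<bar>scaled_dist l u u' - scaled_dist m v v'\<bar> \<le> 4 * R * \<bar>l - m\<bar> / l"
      by (simp flip: add_divide_distrib)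
  qed auto
qed

text \<open>By properness the ball lies in a compact closed ball; a net of precision \<epsilon> l
  for \<open>dist\<close> has precision \<epsilon> after rescaling.\<close>

lemma mtotally_bounded_scaled_ball:
  fixes x :: "'a::metric_space"
  assumes "proper_space TYPE('a)" "0 < l"
  shows "Metric_space.mtotally_bounded {y. dist x y < r} (scaled_dist l) {y. dist x y < r}"
proof -
  have ms: "Metric_space {y. dist x y < r} (scaled_dist l)"
    using Metric_space.subspace[OF Metric_space_scaled[OF \<open>0 < l\<close>]] by blast
  have "compact (cball x r)" using assms(1) unfolding proper_space_def by simp
  then have "Met_TC.mtotally_bounded (cball x r)"
    by (intro Met_TC.compactin_imp_mtotally_bounded) simp
  then have "Met_TC.mtotally_bounded {y. dist x y < r}"
    by (rule Met_TC.mtotally_bounded_subset) auto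
  then have tb: "\<exists>N. finite N \<and> N \<subseteq> {y. dist x y < r} \<and> {y. dist x y < r} \<subseteq> (\<Union>v\<in>N. Met_TC.mball v \<epsilon>)"
    if "0 < \<epsilon>" for \<epsilon> using that unfolding Met_TC.mtotally_bounded_def by blast
  show ?thesis
    unfolding Metric_space.mtotally_bounded_space[OF ms]
  proof (intro allI impI)
    fix \<epsilon> :: real assume "0 < \<epsilon>"
    then have "0 < \<epsilon> * l" using \<open>0 < l\<close> by simp
    from tb[OF this] obtain N where N: "finite N" "N \<subseteq> {y. dist x y < r}"
      "{y. dist x y < r} \<subseteq> (\<Union>v\<in>N. Met_TC.mball v (\<epsilon> * l))" by blast
    have "\<exists>v\<in>N. scaled_dist l v u < \<epsilon>" if u: "u \<in> {y. dist x y < r}" for u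
    proof -
      obtain v where "v \<in> N" "dist v u < \<epsilon> * l" using subsetD[OF N(3) u] by auto
      then show ?thesis using \<open>0 < l\<close> by (auto simp: scaled_dist_def pos_divide_less_eq)
    qed
    then show "\<exists>N. finite N \<and> N \<subseteq> {y. dist x y < r} \<and> (\<forall>u\<in>{y. dist x y < r}. \<exists>v\<in>N. scaled_dist l v u < \<epsilon>)"
      using N by blast
  qed
qed

text \<open>Uniqueness is stated among complete spaces, because Gromov-Hausdorff convergence does
  not distinguish a space from a dense subset that contains the base point.\<close>

theorem lemma2p20:
  fixes x :: "'a::metric_space"
  assumes "proper_space TYPE('a)"
    and "geodesic_space TYPE('a)"
    and "busemann_concave TYPE('a)"
    and "locally_compact_space (Metric_space.mtopology (tangent_cone x) (tangent_dist x))"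
  shows "(\<forall>r>0. gh_precompact {0<..1}
            (\<lambda>l. Metric_space.mball UNIV (scaled_dist l :: 'a \<Rightarrow> 'a \<Rightarrow> real) x r) scaled_dist) \<and>
         pointed_gh_limit (\<lambda>_. UNIV) scaled_dist (\<lambda>_. x)
            (tangent_cone x) (tangent_dist x) (tangent_apex x) (at_right 0) \<and>
         (\<forall>(Y :: 'c set) dY y. Metric_space.mcomplete Y dY \<and>
            pointed_gh_limit (\<lambda>_. UNIV :: 'a set) scaled_dist (\<lambda>_. x) Y dY y (at_right 0) \<longrightarrow>
            pointed_isometric Y dY y (tangent_cone x) (tangent_dist x) (tangent_apex x))"
proof (intro conjI allI impI)
  note bus = assms(3)
  interpret T: Metric_space "tangent_cone x" "tangent_dist x"
    unfolding tangent_cone_def tangent_dist_def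
    by (rule Metric_space.Metric_space_completion[OF Metric_space_cone[OF bus]])
  note TB = tangent_cone_ball_correspondence[OF bus assms(2,4)]
  have TBm: "Metric_space (T.mball (tangent_apex x) r) (tangent_dist x)" for r
    by (rule T.subspace) auto
  have Bm: "Metric_space (Metric_space.mball UNIV (scaled_dist l) x r) (scaled_dist l :: 'a \<Rightarrow> 'a \<Rightarrow> real)"
    if "0 < l" for l r
    using Metric_space.subspace[OF Metric_space_scaled[OF that]] by blast

  show "gh_precompact {0<..1} (\<lambda>l. Metric_space.mball UNIV (scaled_dist l :: 'a \<Rightarrow> 'a \<Rightarrow> real) x r) scaled_dist"
    if "0 < r" for r
    unfolding gh_precompact_def
  proof (intro allI impI)
    fix \<iota> :: "nat \<Rightarrow> real" assume "range \<iota> \<subseteq> {0<..1}"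
    then have \<iota>: "0 < \<iota> n" "\<iota> n \<in> {0..1}" for n by (auto simp: image_subset_iff less_imp_le)
    \<comment> \<open>The scales lie in a half-open interval; compactness of its closure admits the
      limit 0, which is where the tangent cone appears.\<close>
    obtain l \<rho> where l: "l \<in> {0..1}" and \<rho>: "strict_mono \<rho>" and lim: "(\<iota> \<circ> \<rho>) \<longlonglongrightarrow> l"
      using compact_Icc[of 0 "1::real"] \<iota>(2) unfolding compact_def by metis
    define A :: "nat \<Rightarrow> 'a set" where "A n = Metric_space.mball UNIV (scaled_dist (\<iota> (\<rho> n))) x r" for n
    have Am: "Metric_space (A n) (scaled_dist (\<iota> (\<rho> n)))" for n
      unfolding A_def by (rule Bm[OF \<iota>(1)])
    have A_eq: "A n = {y. dist x y < r * \<iota> (\<rho> n)}" for n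
      unfolding A_def by (rule mball_scaled[OF \<iota>(1)])
    then have "x \<in> A n" for n using \<open>0 < r\<close> \<iota>(1) by simp
    then have An: "A n \<noteq> {}" for n by blast
    have "\<exists>(K :: real set) dK. Metric_space K dK \<and> compact_space (Metric_space.mtopology K dK) \<and>
      (\<lambda>n. gh_dist (A n) (scaled_dist (\<iota> (\<rho> n))) K dK) \<longlonglongrightarrow> 0"
    proof (cases "l = 0")
      case True
      \<comment> \<open>The scales are positive, so they tend to 0 from the right and the estimates
        along \<open>at_right 0\<close> apply to the sequence.\<close>
      then have 0: "filterlim (\<lambda>n. \<iota> (\<rho> n)) (at_right 0) sequentially"
        using lim \<iota>(1) by (intro tendsto_imp_filterlim_at_right) (auto simp: o_def)
      have "Metric_space.mtotally_bounded (T.mball (tangent_apex x) r) (tangent_dist x) (T.mball (tangent_apex x) r)"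
        using mtotally_bounded_tangent_ball[OF bus assms(4) \<open>0 < r\<close>] T.mtotally_bounded_absolute by blast
      then show ?thesis
      proof (rule gh_limit_compact_model[OF TBm _ Am An])
        fix \<epsilon> :: real assume "0 < \<epsilon>"
        from eventually_compose_filterlim[OF TB[OF \<open>0 < r\<close> this] 0]
        show "\<forall>\<^sub>F n in sequentially. \<exists>S. correspondence \<epsilon> (A n) (scaled_dist (\<iota> (\<rho> n)))
            (T.mball (tangent_apex x) r) (tangent_dist x) S"
          unfolding A_def by eventually_elim blast
      qed
    next
      case False
      then have "0 < l" using l by simp
      let ?M = "{y. dist x y < r * l}"
      have Mm: "Metric_space ?M (scaled_dist l)"
        using Bm[OF \<open>0 < l\<close>, of r] by (simp only: mball_scaled[OF \<open>0 < l\<close>])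
      show ?thesis
      proof (rule gh_limit_compact_model[OF Mm mtotally_bounded_scaled_ball[OF assms(1) \<open>0 < l\<close>] Am An])
        fix \<epsilon> :: real assume "0 < \<epsilon>"
        \<comment> \<open>This is the error of \<open>scaled_ball_correspondence\<close> between the
          n-th scale and \<open>l\<close>. It tends to 0 because the denominators stay away from
          0.\<close>
        have "((\<lambda>n. 4 * r * \<bar>\<iota> (\<rho> n) - l\<bar> / \<iota> (\<rho> n)) \<longlonglongrightarrow> 4 * r * \<bar>l - l\<bar> / l)"
          using lim \<open>0 < l\<close> by (intro tendsto_intros) (auto simp: o_def)
        then have "\<forall>\<^sub>F n in sequentially. 4 * r * \<bar>\<iota> (\<rho> n) - l\<bar> / \<iota> (\<rho> n) < \<epsilon>"
          using \<open>0 < \<epsilon>\<close> by (intro order_tendstoD(2)) auto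
        then show "\<forall>\<^sub>F n in sequentially. \<exists>S. correspondence \<epsilon> (A n) (scaled_dist (\<iota> (\<rho> n))) ?M (scaled_dist l) S"
        proof eventually_elim
          case (elim n)
          show ?case
            using scaled_ball_correspondence[OF assms(2) \<iota>(1)[of "\<rho> n"] \<open>0 < l\<close> \<open>0 < r\<close>, of x]
              correspondence_mono[OF _ less_imp_le[OF elim]] unfolding A_eq by blast
        qed
      qed
    qed
    then show "\<exists>\<rho> (K :: real set) dK. strict_mono \<rho> \<and> Metric_space K dK \<and>
        compact_space (Metric_space.mtopology K dK) \<and>
        (\<lambda>n. gh_dist (Metric_space.mball UNIV (scaled_dist (\<iota> (\<rho> n)) :: 'a \<Rightarrow> 'a \<Rightarrow> real) x r) (scaled_dist (\<iota> (\<rho> n))) K dK) \<longlonglongrightarrow> 0"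
      using \<rho> unfolding A_def by blast
  qed

  show "pointed_gh_limit (\<lambda>_. UNIV) scaled_dist (\<lambda>_. x) (tangent_cone x) (tangent_dist x) (tangent_apex x) (at_right 0)"
    unfolding pointed_gh_limit_def
  proof (intro conjI allI impI tendsto_ennreal_0I)
    fix r e :: real assume "0 < r" "0 < e"
    then have "0 < e/2" by simp
    show "\<forall>\<^sub>F l in at_right 0. pointed_gh_dist (Metric_space.mball UNIV (scaled_dist l) x r) (scaled_dist l) x
        (T.mball (tangent_apex x) r) (tangent_dist x) (tangent_apex x) \<le> ennreal e"
      using TB[OF \<open>0 < r\<close> \<open>0 < e/2\<close>] eventually_at_right_less[of 0]
    proof eventually_elim
      case (elim l)
      then show ?case
        using pointed_gh_dist_le[OF Bm TBm _ _ \<open>0 < e/2\<close>] by auto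
    qed
  qed (rule T.Metric_space_axioms tangent_apex_in[OF bus])+

  fix Y :: "'c set" and dY y
  assume Y: "Metric_space.mcomplete Y dY \<and>
    pointed_gh_limit (\<lambda>_. UNIV :: 'a set) scaled_dist (\<lambda>_. x) Y dY y (at_right 0)"
  then have Ym: "Metric_space Y dY" and y: "y \<in> Y"
    and Ylim: "\<And>r. 0 < r \<Longrightarrow> ((\<lambda>l. pointed_gh_dist (Metric_space.mball UNIV (scaled_dist l) x r) (scaled_dist l) x
        (Metric_space.mball Y dY y r) dY y) \<longlongrightarrow> 0) (at_right 0)"
    unfolding pointed_gh_limit_def by (elim conjE; simp)+
  interpret Y: Metric_space Y dY by fact
  show "pointed_isometric Y dY y (tangent_cone x) (tangent_dist x) (tangent_apex x)"
  proof (rule pointed_isometric_if_correspondences[OF Ym T.Metric_space_axioms _ mcomplete_tangent_cone[OF bus] y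
        tangent_apex_in[OF bus] mtotally_bounded_tangent_ball[OF bus assms(4)]])
    fix r \<epsilon> :: real assume r: "0 < r" and "0 < \<epsilon>"
    \<comment> \<open>Gromov-Hausdorff distance below \<epsilon>/4 yields distortion \<epsilon>/2,
      and the correspondence with the tangent cone contributes the other \<epsilon>/2.\<close>
    then have \<epsilon>: "0 < \<epsilon>/4" "0 < \<epsilon>/2" "0 < ennreal (\<epsilon>/4)" by (simp_all add: ennreal_less_zero_iff)
    have "\<forall>\<^sub>F l in at_right 0. 0 < l \<and>
        pointed_gh_dist (Metric_space.mball UNIV (scaled_dist l) x r) (scaled_dist l) x
          (Y.mball y r) dY y < ennreal (\<epsilon>/4) \<and>
        (\<exists>S. correspondence (\<epsilon>/2) (Metric_space.mball UNIV (scaled_dist l) x r) (scaled_dist l)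
          (T.mball (tangent_apex x) r) (tangent_dist x) S \<and> (x, tangent_apex x) \<in> S)"
      using eventually_at_right_less[of 0] order_tendstoD(2)[OF Ylim[OF r] \<epsilon>(3)] TB[OF r \<epsilon>(2)]
      by eventually_elim (intro conjI)
    from eventually_happens'[OF trivial_limit_at_right_real this]
    obtain l S where l: "0 < l" "pointed_gh_dist (Metric_space.mball UNIV (scaled_dist l) x r) (scaled_dist l) x
          (Y.mball y r) dY y < ennreal (\<epsilon>/4)"
      and S: "correspondence (\<epsilon>/2) (Metric_space.mball UNIV (scaled_dist l) x r) (scaled_dist l)
          (T.mball (tangent_apex x) r) (tangent_dist x) S" "(x, tangent_apex x) \<in> S"
      by (elim exE conjE)
    have "x \<in> Metric_space.mball UNIV (scaled_dist l) x r"
      using r l(1) by (simp add: mball_scaled)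
    moreover have "y \<in> Y.mball y r" using y r by simp
    ultimately obtain S' where S': "correspondence (2 * (\<epsilon>/4)) (Metric_space.mball UNIV (scaled_dist l) x r) (scaled_dist l)
          (Y.mball y r) dY S'" "(x, y) \<in> S'"
      using correspondence_of_pointed_gh_dist[OF l(2) _ _ \<epsilon>(1)] by blast
    \<comment> \<open>One scale at which both approximations hold suffices: the rescaled ball of X
      is the intermediary and disappears under composition.\<close>
    have "(y, tangent_apex x) \<in> S'\<inverse> O S" using S(2) S'(2) by blast
    then show "\<exists>R. correspondence \<epsilon> (Y.mball y r) dY (T.mball (tangent_apex x) r) (tangent_dist x) R \<and> (y, tangent_apex x) \<in> R"
      using correspondence_comp[OF correspondence_converse[OF S'(1)] S(1)] by auto
  qed (use Y in simp)
qed

end
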